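(* Let $k$ be a field and let $f:\mathbb{Z}_{\ge 3}\to k$ be a function. For $n\ge 3$ let $\mathcal{T}_n$ be the (finite) set of series-reduced planar trees on $n$ leaves, and define $h:\mathbb{Z}_{\ge 3}\to k$ by $$h(n)=\sum_{T\in\mathcal{T}_n}\ \prod_{v\in\mathcal{V}_{\mathrm{int}}(T)} f(\deg(v)),$$ where $\mathcal{V}_{\mathrm{int}}(T)$ is the set of internal vertices of $T$. Let $F(x)=\sum_{n\ge 3} f(n)x^n$ and $H_{\mathrm{tree}}(x)=x^2+\sum_{n\ge 3}h(n)x^n$ in $k[[x]]$. Then $$\frac{1}{x}H_{\mathrm{tree}}(x)=\left(x-\frac{1}{x}F(x)\right)^{\langle -1\rangle}.$$ (The term $x^2$ in $H_{\mathrm{tree}}$ reflects the unique tree in $\mathcal{T}_2$. The unique tree in $\mathcal{T}_1$, which has a single internal vertex, of degree one, is accounted for by passing to $\hat H_{\mathrm{tree}}(x)=h(1)x+H_{\mathrm{tree}}(x)$, where $h(1)=f(1)$ is the weight of that vertex.)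
   Context: For a power series $f\in k[[x]]$ with zero constant term, $f^{\langle -1\rangle}$ denotes its compositional inverse: the power series $g$ with $f(g(x))=g(f(x))=x$. A planar tree on $n$ leaves is a tree properly embedded in a closed disk, considered up to homeomorphism, having $n$ boundary vertices, each of degree one, lying on the boundary of the disk and labelled $1,2,\dots,n$ in clockwise order; all other vertices are internal vertices and lie in the interior of the disk. It is series-reduced if it has no internal vertex of degree $2$. $\mathcal{T}_n$ is the set of series-reduced planar trees on $n$ leaves; for $n\ge 3$ all internal vertices of such a tree have degree at least $3$. For $n\ge3$, $\mathcal{T}_n$ is in bijection with the dissections of a convex $n$-gon by pairwise non-crossing diagonals, an internal vertex of degree $d$ corresponding to a $d$-gonal cell. $\mathcal{T}_2$ consists of the single edge joining the two boundary vertices, with no internal vertices. $\mathcal{T}_1$ consists of one tree: one boundary vertex joined by an edge to one internal vertex of degree $1$. *)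

theory Defs
  imports
    "HOL-Computational_Algebra.Formal_Power_Series"
    "HOL-Combinatorics.Orbits"
begin

text \<open>
  A tree embedded in an oriented disk is determined, up to homeomorphism, by the tree together
  with the clockwise cyclic order of the edges around every vertex (its rotation system) and
  the way its boundary vertices sit on the circle.  Planar trees are represented by this data.
  The boundary vertex labelled \<open>i\<close> is \<open>Boundary i\<close>; the names of internal vertices are
  immaterial and are forgotten by passing to isomorphism classes.
\<close>

datatype vertex = Boundary nat | Internal nat

text \<open>
  Every undirected edge occurs in \<open>arcs\<close> in both directions.  For an edge joining \<open>u\<close> and \<open>v\<close>,
  \<open>rot T v u\<close> is the neighbour of \<open>v\<close> that follows \<open>u\<close> in clockwise order around \<open>v\<close>; other
  values of \<open>rot\<close> are irrelevant.
\<close>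

record plane_graph =
  verts :: "vertex set"
  arcs :: "(vertex \<times> vertex) set"
  rot :: "vertex \<Rightarrow> vertex \<Rightarrow> vertex"

definition simple_cycle :: "('v \<times> 'v) set \<Rightarrow> 'v list \<Rightarrow> bool" where
  "simple_cycle A vs \<longleftrightarrow> length vs \<ge> 3 \<and> distinct vs \<and>
     (\<forall>i. Suc i < length vs \<longrightarrow> (vs ! i, vs ! Suc i) \<in> A) \<and> (last vs, hd vs) \<in> A"

definition is_tree :: "'v set \<Rightarrow> ('v \<times> 'v) set \<Rightarrow> bool" where
  "is_tree V A \<longleftrightarrow>
     finite V \<and> V \<noteq> {} \<and> A \<subseteq> V \<times> V \<and> sym A \<and> irrefl A \<and>
     (\<forall>u\<in>V. \<forall>v\<in>V. (u, v) \<in> A\<^sup>*) \<and> (\<nexists>vs. simple_cycle A vs)"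

definition neighbours :: "plane_graph \<Rightarrow> vertex \<Rightarrow> vertex set" where
  "neighbours T v = arcs T `` {v}"

definition degree :: "plane_graph \<Rightarrow> vertex \<Rightarrow> nat" where
  "degree T v = card (neighbours T v)"

definition boundary_vertices :: "plane_graph \<Rightarrow> vertex set" where
  "boundary_vertices T = verts T \<inter> range Boundary"

definition internal_vertices :: "plane_graph \<Rightarrow> vertex set" where
  "internal_vertices T = verts T \<inter> range Internal"

text \<open>
  \<open>contour\<close> walks along the tree, always keeping the same region of the complement on its left:
  having arrived at \<open>v\<close> from \<open>u\<close>, it leaves along the edge that follows clockwise.  Started at a
  boundary vertex, the walk therefore first meets the boundary again at the next boundary vertex
  in clockwise direction on the circle.
\<close>

fun contour :: "plane_graph \<Rightarrow> vertex \<times> vertex \<Rightarrow> vertex \<times> vertex" where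
  "contour T (u, v) = (v, rot T v u)"

definition next_boundary :: "plane_graph \<Rightarrow> vertex \<Rightarrow> vertex \<Rightarrow> bool" where
  "next_boundary T b b' \<longleftrightarrow>
     (\<exists>u m. (b, u) \<in> arcs T \<and> b' \<in> boundary_vertices T \<and>
        snd ((contour T ^^ m) (b, u)) = b' \<and>
        (\<forall>j<m. snd ((contour T ^^ j) (b, u)) \<in> internal_vertices T))"

definition planar_tree :: "nat \<Rightarrow> plane_graph \<Rightarrow> bool" where
  "planar_tree n T \<longleftrightarrow>
     is_tree (verts T) (arcs T) \<and>
     (\<forall>v\<in>verts T. cyclic_on (rot T v) (neighbours T v)) \<and>
     boundary_vertices T = Boundary ` {1..n} \<and>
     (\<forall>b\<in>boundary_vertices T. degree T b = 1) \<and>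
     (\<forall>i\<in>{1..n}. next_boundary T (Boundary i) (Boundary (if i = n then 1 else Suc i)))"

definition series_reduced :: "plane_graph \<Rightarrow> bool" where
  "series_reduced T \<longleftrightarrow> (\<forall>v\<in>internal_vertices T. degree T v \<noteq> 2)"

definition planar_tree_iso :: "plane_graph \<Rightarrow> plane_graph \<Rightarrow> bool" where
  "planar_tree_iso S T \<longleftrightarrow>
     (\<exists>\<phi>. bij_betw \<phi> (verts S) (verts T) \<and>
        \<phi> ` internal_vertices S = internal_vertices T \<and>
        (\<forall>b\<in>boundary_vertices S. \<phi> b = b) \<and>
        (\<forall>u\<in>verts S. \<forall>v\<in>verts S. (\<phi> u, \<phi> v) \<in> arcs T \<longleftrightarrow> (u, v) \<in> arcs S) \<and>
        (\<forall>(u, v)\<in>arcs S. \<phi> (rot S v u) = rot T (\<phi> v) (\<phi> u)))"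

text \<open>
  The leaves of a tree are its boundary vertices: internal vertices of degree one are excluded, so
  that internal vertices have degree at least three and there are finitely many trees for each
  \<open>n\<close>.  The single exception is the tree on one leaf, whose only internal vertex has degree one.
\<close>

definition reduced_trees :: "nat \<Rightarrow> plane_graph set" where
  "reduced_trees n = {T. planar_tree n T \<and> series_reduced T \<and>
     (\<forall>v\<in>internal_vertices T. degree T v = 1 \<longrightarrow> n = 1 \<and> internal_vertices T = {v})}"

definition reduced_tree_rel :: "nat \<Rightarrow> (plane_graph \<times> plane_graph) set" where
  "reduced_tree_rel n =
     {(S, T). S \<in> reduced_trees n \<and> T \<in> reduced_trees n \<and> planar_tree_iso S T}"

definition tree_classes :: "nat \<Rightarrow> plane_graph set set" where
  "tree_classes n = reduced_trees n // reduced_tree_rel n"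

definition weight :: "(nat \<Rightarrow> 'a::field) \<Rightarrow> plane_graph \<Rightarrow> 'a" where
  "weight f T = (\<Prod>v\<in>internal_vertices T. f (degree T v))"

text \<open>
  The weight is constant on every class (\<open>weight_class\<close> below), so the choice of the
  representative does not matter.
\<close>

definition tree_sum :: "(nat \<Rightarrow> 'a::field) \<Rightarrow> nat \<Rightarrow> 'a" where
  "tree_sum f n = (\<Sum>C\<in>tree_classes n. weight f (SOME T. T \<in> C))"

definition F_series :: "(nat \<Rightarrow> 'a::field) \<Rightarrow> 'a fps" where
  "F_series f = Abs_fps (\<lambda>n. if n \<ge> 3 then f n else 0)"

definition H_tree :: "(nat \<Rightarrow> 'a::field) \<Rightarrow> 'a fps" where
  "H_tree f = fps_X ^ 2 + Abs_fps (\<lambda>n. if n \<ge> 3 then tree_sum f n else 0)"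

lemma reduced_treesD:
  assumes "T \<in> reduced_trees n"
  shows "arcs T \<subseteq> verts T \<times> verts T" "sym (arcs T)"
    "\<And>u v. (u, v) \<in> arcs T \<Longrightarrow> (v, rot T v u) \<in> arcs T"
proof -
  show A: "arcs T \<subseteq> verts T \<times> verts T" and S: "sym (arcs T)"
    using assms by (auto simp: reduced_trees_def planar_tree_def is_tree_def)
  fix u v assume uv: "(u, v) \<in> arcs T"
  have "cyclic_on (rot T v) (neighbours T v)"
    using assms uv A by (auto simp: reduced_trees_def planar_tree_def)
  moreover have "u \<in> neighbours T v"
    using uv S by (auto simp: neighbours_def sym_def)
  ultimately have "(rot T v ^^ 1) u \<in> neighbours T v"
    by (rule cyclic_on_funpow_in)
  then show "(v, rot T v u) \<in> arcs T" by (simp add: neighbours_def)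
qed

lemma iso_degree:
  assumes bij: "bij_betw \<phi> (verts S) (verts T)"
    and S: "arcs S \<subseteq> verts S \<times> verts S" and T: "arcs T \<subseteq> verts T \<times> verts T"
    and arcs: "\<forall>u\<in>verts S. \<forall>v\<in>verts S. (\<phi> u, \<phi> v) \<in> arcs T \<longleftrightarrow> (u, v) \<in> arcs S"
    and v: "v \<in> verts S"
  shows "degree T (\<phi> v) = degree S v"
proof -
  have "neighbours T (\<phi> v) = \<phi> ` neighbours S v"
  proof (intro equalityI subsetI)
    fix w assume "w \<in> neighbours T (\<phi> v)"
    then have w: "(\<phi> v, w) \<in> arcs T" by (simp add: neighbours_def)
    then obtain u where "u \<in> verts S" "w = \<phi> u"
      using T bij by (auto simp: bij_betw_def)
    with w arcs v show "w \<in> \<phi> ` neighbours S v" by (auto simp: neighbours_def)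
  next
    fix w assume "w \<in> \<phi> ` neighbours S v"
    then obtain u where "(v, u) \<in> arcs S" "w = \<phi> u" by (auto simp: neighbours_def)
    with S arcs v show "w \<in> neighbours T (\<phi> v)" by (auto simp: neighbours_def)
  qed
  moreover have "inj_on \<phi> (neighbours S v)"
    using bij S by (auto simp: bij_betw_def neighbours_def intro: inj_on_subset)
  ultimately show ?thesis by (simp add: degree_def card_image)
qed

lemma weight_iso:
  assumes "(S, T) \<in> reduced_tree_rel n"
  shows "weight f S = weight f T"
proof -
  have ST: "S \<in> reduced_trees n" "T \<in> reduced_trees n"
    using assms by (auto simp: reduced_tree_rel_def)
  obtain \<phi> where bij: "bij_betw \<phi> (verts S) (verts T)"
    and int: "\<phi> ` internal_vertices S = internal_vertices T"
    and arcs: "\<forall>u\<in>verts S. \<forall>v\<in>verts S. (\<phi> u, \<phi> v) \<in> arcs T \<longleftrightarrow> (u, v) \<in> arcs S"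
    using assms by (auto simp: reduced_tree_rel_def planar_tree_iso_def)
  have "bij_betw \<phi> (internal_vertices S) (internal_vertices T)"
    using bij int by (auto simp: internal_vertices_def bij_betw_def intro: inj_on_subset)
  then have "weight f T = (\<Prod>v\<in>internal_vertices S. f (degree T (\<phi> v)))"
    unfolding weight_def by (rule prod.reindex_bij_betw[symmetric])
  also have "\<dots> = weight f S"
    unfolding weight_def
    by (rule prod.cong)
      (auto simp: internal_vertices_def
         iso_degree[OF bij reduced_treesD(1)[OF ST(1)] reduced_treesD(1)[OF ST(2)] arcs])
  finally show ?thesis by simp
qed

lemma equiv_reduced_tree_rel: "equiv (reduced_trees n) (reduced_tree_rel n)"
proof (rule equivI)
  show "reduced_tree_rel n \<subseteq> reduced_trees n \<times> reduced_trees n"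
    by (auto simp: reduced_tree_rel_def)
  have "planar_tree_iso T T" for T
    unfolding planar_tree_iso_def by (rule exI[of _ id]) auto
  then show "refl_on (reduced_trees n) (reduced_tree_rel n)"
    by (auto simp: refl_on_def reduced_tree_rel_def)
  show "sym (reduced_tree_rel n)"
  proof (rule symI)
    fix S T assume ST: "(S, T) \<in> reduced_tree_rel n"
    then have S: "S \<in> reduced_trees n" and T: "T \<in> reduced_trees n"
      by (auto simp: reduced_tree_rel_def)
    obtain \<phi> where bij: "bij_betw \<phi> (verts S) (verts T)"
      and int: "\<phi> ` internal_vertices S = internal_vertices T"
      and bd: "\<forall>b\<in>boundary_vertices S. \<phi> b = b"
      and arcs: "\<forall>u\<in>verts S. \<forall>v\<in>verts S. (\<phi> u, \<phi> v) \<in> arcs T \<longleftrightarrow> (u, v) \<in> arcs S"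
      and rot: "\<forall>(u, v)\<in>arcs S. \<phi> (rot S v u) = rot T (\<phi> v) (\<phi> u)"
      using ST by (auto simp: reduced_tree_rel_def planar_tree_iso_def)
    define \<psi> where "\<psi> = the_inv_into (verts S) \<phi>"
    have inj: "inj_on \<phi> (verts S)" and im: "\<phi> ` verts S = verts T"
      using bij by (auto simp: bij_betw_def)
    have \<psi>: "\<psi> (\<phi> v) = v" if "v \<in> verts S" for v
      using that inj by (simp add: \<psi>_def the_inv_into_f_f)
    have bdeq: "boundary_vertices S = boundary_vertices T"
      using S T by (simp add: reduced_trees_def planar_tree_def)
    have "bij_betw \<psi> (verts T) (verts S)"
      using bij by (simp add: \<psi>_def bij_betw_the_inv_into)
    moreover have "\<psi> ` internal_vertices T = internal_vertices S"
    proof -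
      have "\<psi> ` \<phi> ` internal_vertices S = id ` internal_vertices S"
        unfolding image_image by (rule image_cong) (auto simp: internal_vertices_def \<psi>)
      then show ?thesis by (simp add: int)
    qed
    moreover have "\<forall>b\<in>boundary_vertices T. \<psi> b = b"
      using bd \<psi> unfolding bdeq[symmetric] by (metis IntD1 boundary_vertices_def)
    moreover have "\<forall>u\<in>verts T. \<forall>v\<in>verts T. (\<psi> u, \<psi> v) \<in> arcs S \<longleftrightarrow> (u, v) \<in> arcs T"
      using arcs \<psi> by (auto simp: im[symmetric])
    moreover have "\<forall>(u, v)\<in>arcs T. \<psi> (rot T v u) = rot S (\<psi> v) (\<psi> u)"
    proof (safe)
      fix u v assume uv: "(u, v) \<in> arcs T"
      then have "u \<in> \<phi> ` verts S" "v \<in> \<phi> ` verts S"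
        unfolding im using reduced_treesD(1)[OF T] by auto
      then obtain u' v' where *: "u' \<in> verts S" "v' \<in> verts S" "u = \<phi> u'" "v = \<phi> v'"
        by (elim imageE)
      then have a: "(u', v') \<in> arcs S" using uv arcs by auto
      then have "rot S v' u' \<in> verts S"
        using reduced_treesD[OF S] by blast
      moreover have "rot T v u = \<phi> (rot S v' u')"
        using bspec[OF rot a] * by simp
      ultimately show "\<psi> (rot T v u) = rot S (\<psi> v) (\<psi> u)"
        using * by (simp add: \<psi>)
    qed
    ultimately show "(T, S) \<in> reduced_tree_rel n"
      using S T unfolding reduced_tree_rel_def planar_tree_iso_def by blast
  qed
  show "trans (reduced_tree_rel n)"
  proof (rule transI)
    fix R S T assume RS: "(R, S) \<in> reduced_tree_rel n" and ST: "(S, T) \<in> reduced_tree_rel n"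
    then have mem: "R \<in> reduced_trees n" "S \<in> reduced_trees n" "T \<in> reduced_trees n"
      by (auto simp: reduced_tree_rel_def)
    obtain \<phi> where bij1: "bij_betw \<phi> (verts R) (verts S)"
      and int1: "\<phi> ` internal_vertices R = internal_vertices S"
      and bd1: "\<forall>b\<in>boundary_vertices R. \<phi> b = b"
      and arcs1: "\<forall>u\<in>verts R. \<forall>v\<in>verts R. (\<phi> u, \<phi> v) \<in> arcs S \<longleftrightarrow> (u, v) \<in> arcs R"
      and rot1: "\<forall>(u, v)\<in>arcs R. \<phi> (rot R v u) = rot S (\<phi> v) (\<phi> u)"
      using RS by (auto simp: reduced_tree_rel_def planar_tree_iso_def)
    obtain \<psi> where bij2: "bij_betw \<psi> (verts S) (verts T)"
      and int2: "\<psi> ` internal_vertices S = internal_vertices T"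
      and bd2: "\<forall>b\<in>boundary_vertices S. \<psi> b = b"
      and arcs2: "\<forall>u\<in>verts S. \<forall>v\<in>verts S. (\<psi> u, \<psi> v) \<in> arcs T \<longleftrightarrow> (u, v) \<in> arcs S"
      and rot2: "\<forall>(u, v)\<in>arcs S. \<psi> (rot S v u) = rot T (\<psi> v) (\<psi> u)"
      using ST by (auto simp: reduced_tree_rel_def planar_tree_iso_def)
    have bdeq: "boundary_vertices R = boundary_vertices S"
      using mem by (simp add: reduced_trees_def planar_tree_def)
    have im: "\<phi> v \<in> verts S" if "v \<in> verts R" for v
      using that bij1 by (auto simp: bij_betw_def)
    have "bij_betw (\<psi> \<circ> \<phi>) (verts R) (verts T)"
      using bij1 bij2 by (rule bij_betw_trans)
    moreover have "(\<psi> \<circ> \<phi>) ` internal_vertices R = internal_vertices T"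
      by (simp only: image_comp[symmetric] int1 int2)
    moreover have "\<forall>b\<in>boundary_vertices R. (\<psi> \<circ> \<phi>) b = b"
      using bd1 bd2 bdeq by simp
    moreover have "\<forall>u\<in>verts R. \<forall>v\<in>verts R.
        ((\<psi> \<circ> \<phi>) u, (\<psi> \<circ> \<phi>) v) \<in> arcs T \<longleftrightarrow> (u, v) \<in> arcs R"
      using arcs1 arcs2 im by simp
    moreover have "\<forall>(u, v)\<in>arcs R. (\<psi> \<circ> \<phi>) (rot R v u) = rot T ((\<psi> \<circ> \<phi>) v) ((\<psi> \<circ> \<phi>) u)"
    proof (safe)
      fix u v assume uv: "(u, v) \<in> arcs R"
      then have "u \<in> verts R" "v \<in> verts R" using reduced_treesD(1)[OF mem(1)] by auto
      then have "(\<phi> u, \<phi> v) \<in> arcs S" using uv arcs1 by simp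
      then show "(\<psi> \<circ> \<phi>) (rot R v u) = rot T ((\<psi> \<circ> \<phi>) v) ((\<psi> \<circ> \<phi>) u)"
        using bspec[OF rot1 uv] bspec[OF rot2, of "(\<phi> u, \<phi> v)"] by simp
    qed
    ultimately show "(R, T) \<in> reduced_tree_rel n"
      using mem unfolding reduced_tree_rel_def planar_tree_iso_def by blast
  qed
qed

lemma weight_class:
  assumes "C \<in> tree_classes n" "T \<in> C"
  shows "weight f (SOME T. T \<in> C) = weight f T"
proof -
  have "(SOME T. T \<in> C) \<in> C" using assms(2) by (rule someI)
  then show ?thesis
    using assms weight_iso in_quotient_imp_in_rel[OF equiv_reduced_tree_rel, of C n]
    unfolding tree_classes_def by (metis empty_subsetI insert_subset)
qed

end

theory Submission
  imports Defs "HOL-Combinatorics.Cycles"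
begin

text \<open>
  Rooting a tree at its leaf \<open>n\<close> and following the contour clockwise turns an isomorphism class of
  planar trees on \<open>n\<close> leaves into an ordered rooted tree with \<open>n - 1\<close> leaves in which every
  internal vertex has at least two children; a vertex of degree \<open>d\<close> gets \<open>d - 1\<close> children.
  The clockwise condition on the labels says exactly that the leaves are met in the order
  \<open>1, \<dots>, n - 1\<close>.  Cutting an ordered tree at its root gives
  \<open>G = x + (\<Sum>d\<ge>3. f d * G ^ (d - 1))\<close> for the generating function \<open>G\<close> of these trees, so
  \<open>(x - F / x) \<circ> G = x\<close>.
\<close>

unbundle fps_syntax

section \<open>Ordered trees and their generating series\<close>

text \<open>The difficulty lies in the graphs: internal vertices have no canonical names, and
  connectedness, acyclicity and the clockwise labelling are global conditions. The bridge is the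
  list \<open>planted_adj\<close>, which records every vertex with its neighbours in clockwise order
  from the parent. Arcs, rotations, degrees and weights can all be read off from it, so that passing
  between graphs and ordered trees reduces to statements about lists. Acyclicity is what turns a
  graph into a tree: it makes the recursive unfolding stop and keeps it from meeting a vertex twice.
  In the other direction it comes from a rank function that grows along the preorder. The contour
  links the labels to the ordering, because walking round an ordered tree meets its leaves from left
  to right. On the side of power series, the recursion only yields a right inverse of
  \<open>x - F / x\<close> under composition; this is enough, because the linear coefficient is 1
  and a left inverse therefore exists as well.\<close>

datatype 'v plane_tree = Node (label: 'v) (subtrees: "'v plane_tree list")

fun leaves :: "'v plane_tree \<Rightarrow> 'v list" where
  "leaves (Node v ts) = (if ts = [] then [v] else concat (map leaves ts))"

text \<open>A vertex with exactly one child would have degree two, as the edge to the parent counts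
  as well.\<close>

fun reduced :: "'v plane_tree \<Rightarrow> bool" where
  "reduced (Node v ts) \<longleftrightarrow> length ts \<noteq> 1 \<and> (\<forall>t\<in>set ts. reduced t)"

text \<open>\<open>Suc (length ts)\<close> is the degree, with the edge to the parent included.
  Leaves contribute 1, since only internal vertices carry a weight.\<close>

fun tree_weight :: "(nat \<Rightarrow> 'a::comm_monoid_mult) \<Rightarrow> 'v plane_tree \<Rightarrow> 'a" where
  "tree_weight f (Node v ts) =
     (if ts = [] then 1 else f (Suc (length ts))) * prod_list (map (tree_weight f) ts)"

lemma leaves_not_Nil [simp]: "leaves t \<noteq> []"
proof (induction t)
  case (Node v ts)
  then show ?case by (cases ts) auto
qed

lemma length_leaves_pos: "0 < length (leaves t)"
  by simp

lemma leaves_map: "leaves (map_plane_tree g t) = map g (leaves t)"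
  by (induction t) (auto simp: map_concat intro!: arg_cong[where f = concat])

lemma reduced_map: "reduced (map_plane_tree g t) \<longleftrightarrow> reduced t"
  by (induction t) auto

lemma tree_weight_map: "tree_weight f (map_plane_tree g t) = tree_weight f t"
  by (induction t) (auto intro!: arg_cong[where f = prod_list] arg_cong2[where f = "(*)"])

text \<open>Labels in \<open>unit\<close> carry no information, so these trees are what remains of a
  labelled tree when the vertex names are forgotten.\<close>

definition shapes :: "nat \<Rightarrow> unit plane_tree set" where
  "shapes m = {t. reduced t \<and> length (leaves t) = m}"

text \<open>The possible lists of subtrees below a root with \<open>k\<close> children; they will
  expand the \<open>k\<close>-th power of the generating series.\<close>

definition forests :: "nat \<Rightarrow> nat \<Rightarrow> unit plane_tree list set" where
  "forests k m = {ts. length ts = k \<and> (\<forall>t\<in>set ts. reduced t) \<and>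
     sum_list (map (\<lambda>t. length (leaves t)) ts) = m}"

lemma shapes_0: "shapes 0 = {}"
  by (auto simp: shapes_def)

lemma forest_length_le: "ts \<in> forests k m \<Longrightarrow> k \<le> m"
proof -
  have "length ts \<le> sum_list (map (\<lambda>t. length (leaves t)) ts)" for ts :: "'b plane_tree list"
  proof (induction ts)
    case (Cons t ts)
    then show ?case using length_leaves_pos[of t] by (simp del: leaves_not_Nil length_greater_0_conv)
  qed simp
  then show "ts \<in> forests k m \<Longrightarrow> k \<le> m"
    unfolding forests_def by blast
qed

text \<open>Cut at the root. The number \<open>k\<close> of children is at least 2 by reducedness
  and at most \<open>m\<close> because every subtree has a leaf.\<close>

lemma shapes_unfold:
  "shapes m = (if m = 1 then {Node () []} else {}) \<union> (\<Union>k\<in>{2..m}. Node () ` forests k m)"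
proof (intro equalityI subsetI)
  fix t assume t: "t \<in> shapes m"
  obtain ts where ts: "t = Node () ts" by (cases t) auto
  show "t \<in> (if m = 1 then {Node () []} else {}) \<union> (\<Union>k\<in>{2..m}. Node () ` forests k m)"
  proof (cases "ts = []")
    case False
    then have "ts \<in> forests (length ts) m"
      using t ts by (auto simp: shapes_def forests_def length_concat comp_def)
    moreover have "2 \<le> length ts" using False t ts
      by (cases ts; cases "tl ts") (auto simp: shapes_def)
    ultimately show ?thesis using forest_length_le ts by fastforce
  qed (use t ts in \<open>auto simp: shapes_def\<close>)
next
  fix t assume "t \<in> (if m = 1 then {Node () []} else {}) \<union> (\<Union>k\<in>{2..m}. Node () ` forests k m)"
  then show "t \<in> shapes m"
    by (auto simp: shapes_def forests_def length_concat comp_def split: if_splits)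
qed

text \<open>With at least two subtrees, each one has fewer leaves than the whole tree, because some
  sibling takes at least one. Hence strong induction on the number of leaves applies.\<close>

lemma finite_shapes: "finite (shapes m)"
proof (induction m rule: less_induct)
  case (less m)
  have "finite (forests k m)" if "k \<ge> 2" for k
  proof -
    have "set ts \<subseteq> (\<Union>j<m. shapes j)" if ts: "ts \<in> forests k m" for ts
    proof
      fix t assume t: "t \<in> set ts"
      then obtain xs ys where split: "ts = xs @ t # ys" by (meson split_list)
      then have "xs @ ys \<noteq> []" using ts \<open>k \<ge> 2\<close> by (auto simp: forests_def)
      then obtain s where "s \<in> set (xs @ ys)" by (metis last_in_set)
      then have "0 < sum_list (map (\<lambda>t. length (leaves t)) (xs @ ys))"
        by (auto simp: sum_list_eq_0_iff simp flip: neq0_conv simp del: map_append)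
      then have "length (leaves t) < m" using ts split by (auto simp: forests_def)
      then show "t \<in> (\<Union>j<m. shapes j)" using ts t by (auto simp: forests_def shapes_def)
    qed
    then have "forests k m \<subseteq> {ts. set ts \<subseteq> (\<Union>j<m. shapes j) \<and> length ts = k}"
      by (auto simp: forests_def)
    moreover have "finite (\<Union>j<m. shapes j)" using less by auto
    ultimately show ?thesis by (rule finite_subset[OF _ finite_lists_length_eq])
  qed
  then show ?case by (subst shapes_unfold) auto
qed

lemma forests_Suc:
  "forests (Suc k) m = (\<lambda>(t, ts). t # ts) ` (\<Union>i\<in>{0..m}. shapes i \<times> forests k (m - i))"
proof (intro equalityI subsetI)
  fix us assume us: "us \<in> forests (Suc k) m"
  then obtain t ts where "us = t # ts" by (auto simp: forests_def length_Suc_conv)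
  with us have "(t, ts) \<in> shapes (length (leaves t)) \<times> forests k (m - length (leaves t))"
    "length (leaves t) \<le> m"
    by (auto simp: forests_def shapes_def)
  with \<open>us = t # ts\<close>
  show "us \<in> (\<lambda>(t, ts). t # ts) ` (\<Union>i\<in>{0..m}. shapes i \<times> forests k (m - i))"
    by (intro image_eqI[of _ _ "(t, ts)"]) auto
qed (auto simp: forests_def shapes_def)

lemma finite_forests: "finite (forests k m)"
proof (induction k arbitrary: m)
  case 0
  show ?case by (rule finite_subset[of _ "{[]}"]) (auto simp: forests_def)
qed (auto simp: forests_Suc finite_shapes)

definition shape_series :: "(nat \<Rightarrow> 'a::field) \<Rightarrow> 'a fps" where
  "shape_series f = Abs_fps (\<lambda>m. \<Sum>t\<in>shapes m. tree_weight f t)"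

lemma shape_series_nth: "shape_series f $ m = (\<Sum>t\<in>shapes m. tree_weight f t)"
  by (simp add: shape_series_def)

lemma shape_series_power_nth:
  "(shape_series f ^ k) $ m = (\<Sum>ts\<in>forests k m. prod_list (map (tree_weight f) ts))"
proof (induction k arbitrary: m)
  case 0
  have "forests 0 m = (if m = 0 then {[]} else {})" by (auto simp: forests_def)
  then show ?case by simp
next
  case (Suc k)
  let ?w = "\<lambda>ts. prod_list (map (tree_weight f) ts)"
  have "(shape_series f ^ Suc k) $ m =
      (\<Sum>i=0..m. \<Sum>(t, ts)\<in>shapes i \<times> forests k (m - i). ?w (t # ts))"
    by (simp add: fps_mult_nth Suc shape_series_nth sum_product sum.cartesian_product)
  \<comment> \<open>The union is disjoint because \<open>i\<close> is the number of leaves of the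
    leading tree.\<close>
  also have "\<dots> = (\<Sum>(t, ts)\<in>(\<Union>i\<in>{0..m}. shapes i \<times> forests k (m - i)). ?w (t # ts))"
    by (rule sum.UNION_disjoint[symmetric])
      (simp_all add: finite_shapes finite_forests, auto simp: shapes_def)
  also have "\<dots> = (\<Sum>ts\<in>forests (Suc k) m. ?w ts)"
    unfolding forests_Suc by (subst sum.reindex) (auto simp: inj_on_def case_prod_unfold)
  finally show ?case .
qed

text \<open>Compare coefficients using the cut at the root: dividing \<open>F_series f\<close> by
  \<open>fps_X\<close> moves \<open>f (Suc k)\<close> to exponent \<open>k\<close>, which matches a
  root with \<open>k\<close> children and degree \<open>Suc k\<close>.\<close>

lemma shape_series_eq:
  "shape_series f = fps_X + ((F_series f / fps_X) oo shape_series f)"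
proof (rule fps_ext)
  fix m
  let ?P = "F_series f / fps_X" and ?w = "\<lambda>ts. prod_list (map (tree_weight f) ts)"
  have "(\<Sum>t\<in>shapes m. tree_weight f t) =
      (\<Sum>t\<in>(if m = 1 then {Node () []} else {}). tree_weight f t) +
      (\<Sum>t\<in>(\<Union>k\<in>{2..m}. Node () ` forests k m). tree_weight f t)"
    by (subst shapes_unfold, rule sum.union_disjoint)
      (auto simp: forests_def intro!: finite_imageI finite_forests[unfolded forests_def])
  also have "(\<Sum>t\<in>(\<Union>k\<in>{2..m}. Node () ` forests k m). tree_weight f t) =
      (\<Sum>k=2..m. \<Sum>t\<in>Node () ` forests k m. tree_weight f t)"
    by (rule sum.UNION_disjoint) (auto simp: forests_def intro!: finite_imageI finite_forests[unfolded forests_def])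
  also have "\<dots> = (\<Sum>k=2..m. f (Suc k) * (\<Sum>ts\<in>forests k m. ?w ts))"
    by (intro sum.cong refl, subst sum.reindex)
      (auto simp: inj_on_def sum_distrib_left forests_def intro!: sum.cong)
  \<comment> \<open>The added terms \<open>k = 0\<close> and \<open>k = 1\<close> vanish, since
    \<open>F_series\<close> starts with the exponent 3.\<close>
  also have "\<dots> = (\<Sum>k=0..m. ?P $ k * (shape_series f ^ k) $ m)"
    by (rule sum.mono_neutral_cong_left) (auto simp: F_series_def shape_series_power_nth)
  finally show "shape_series f $ m = (fps_X + (?P oo shape_series f)) $ m"
    by (simp add: shape_series_def fps_compose_nth)
qed

lemma shape_series_fps_inv: "shape_series f = fps_inv (fps_X - F_series f / fps_X)"
proof -
  let ?A = "fps_X - F_series f / fps_X" and ?G = "shape_series f"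
  have G0: "?G $ 0 = 0" by (simp add: shape_series_def shapes_0)
  have A0: "?A $ 0 = 0" and A1: "?A $ 1 \<noteq> 0" by (auto simp: F_series_def)
  have "fps_X oo ?G = ?G" using G0 by simp
  then have AG: "?A oo ?G = fps_X"
    using shape_series_eq[of f] by (simp add: fps_compose_sub_distrib algebra_simps)
  \<comment> \<open>The linear coefficient of \<open>?A\<close> is nonzero, so
    \<open>fps_inv ?A\<close> is a left inverse; associativity of composition identifies it with the
    right inverse \<open>?G\<close>.\<close>
  have "?G = (fps_inv ?A oo ?A) oo ?G" unfolding fps_inv[OF A0 A1] using G0 by simp
  also have "\<dots> = fps_inv ?A oo (?A oo ?G)"
    by (rule fps_compose_assoc[symmetric, OF G0 A0])
  finally show ?thesis unfolding AG by simp
qed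

section \<open>Neighbour lists\<close>

text \<open>Every vertex with its neighbours in clockwise order, starting at the parent; \<open>u\<close> is the parent
  of the root of the tree.\<close>

fun adj :: "'v \<Rightarrow> 'v plane_tree \<Rightarrow> ('v \<times> 'v list) list" where
  "adj u (Node v ts) = (v, u # map label ts) # concat (map (adj v) ts)"

fun preorder :: "'v plane_tree \<Rightarrow> 'v list" where
  "preorder (Node v ts) = v # concat (map preorder ts)"

text \<open>In \<open>adj r t\<close> the vertex \<open>r\<close> only occurs as the parent of the
  root; here it receives its own entry, that of a leaf.\<close>

definition planted_adj :: "'v \<Rightarrow> 'v plane_tree \<Rightarrow> ('v \<times> 'v list) list" where
  "planted_adj r t = (r, [label t]) # adj r t"

text \<open>One full clockwise turn around \<open>v\<close>, cut open at an arbitrary neighbour. The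
  \<open>rotate1\<close> equation says that every entry is followed by the next and the last one by
  the head.\<close>

definition rot_list :: "plane_graph \<Rightarrow> vertex \<Rightarrow> vertex list \<Rightarrow> bool" where
  "rot_list T v xs \<longleftrightarrow>
     distinct xs \<and> set xs = neighbours T v \<and> map (rot T v) xs = rotate1 xs"

text \<open>The condition is local at each vertex; that no vertex is repeated is derived from
  acyclicity in \<open>describes_distinct\<close>.\<close>

definition describes :: "plane_graph \<Rightarrow> vertex \<Rightarrow> vertex plane_tree \<Rightarrow> bool" where
  "describes T u t \<longleftrightarrow> (\<forall>(v, xs)\<in>set (adj u t). rot_list T v xs)"

lemma describes_Node:
  "describes T u (Node v ts) \<longleftrightarrow>
     rot_list T v (u # map label ts) \<and> (\<forall>t\<in>set ts. describes T v t)"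
  by (auto simp: describes_def)

lemma map_fst_adj: "map fst (adj u t) = preorder t"
  by (induction u t rule: adj.induct)
    (auto simp: map_concat comp_def intro!: arg_cong[where f = concat])

lemma set_preorder: "set (preorder t) = set_plane_tree t"
  by (induction t) auto

lemma label_in_set: "label t \<in> set_plane_tree t"
  by (cases t) auto

lemma leaves_subset: "set (leaves t) \<subseteq> set_plane_tree t"
  by (induction t) auto

lemma distinct_leaves: "distinct (preorder t) \<Longrightarrow> distinct (leaves t)"
proof (induction t)
  case (Node v ts)
  have "distinct (concat (map leaves us))"
    if "set us \<subseteq> set ts" "distinct (concat (map preorder us))" for us
    using that
  proof (induction us)
    case (Cons u us)
    have sub: "set (leaves u) \<subseteq> set (preorder u)" for u :: "'a plane_tree"
      using leaves_subset by (simp add: set_preorder)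
    have "set (leaves u) \<inter> set (concat (map leaves us)) \<subseteq>
        set (preorder u) \<inter> set (concat (map preorder us))"
      using sub by (intro Int_mono) (auto simp: set_concat)
    moreover have "set (preorder u) \<inter> set (concat (map preorder us)) = {}"
      using Cons.prems by simp
    ultimately have "set (leaves u) \<inter> set (concat (map leaves us)) = {}"
      by (metis subset_empty)
    then show ?case using Cons Node.IH by simp
  qed simp
  then show ?case using Node.prems by auto
qed

section \<open>Rotations as cyclic lists\<close>

lemma map_rotate1_iff:
  "map g xs = rotate1 xs \<longleftrightarrow> (\<forall>i<length xs. g (xs ! i) = xs ! (Suc i mod length xs))"
  by (simp add: list_eq_iff_nth_eq nth_rotate1)

lemma funpow_of_rotate1:
  assumes "map g xs = rotate1 xs" "xs \<noteq> []"
  shows "(g ^^ i) (hd xs) = xs ! (i mod length xs)"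
proof (induction i)
  case 0
  then show ?case using assms by (simp add: hd_conv_nth)
next
  case (Suc i)
  then show ?case using assms by (simp add: map_rotate1_iff mod_Suc_eq)
qed

lemma cyclic_on_of_rotate1:
  assumes "map g xs = rotate1 xs" "xs \<noteq> []"
  shows "cyclic_on g (set xs)"
  unfolding cyclic_on_def orbit_altdef
proof (intro bexI set_eqI iffI)
  show "hd xs \<in> set xs" using assms by simp
next
  fix x assume "x \<in> set xs"
  then obtain i where "i < length xs" "xs ! i = x" by (auto simp: in_set_conv_nth)
  then have "(g ^^ (i + length xs)) (hd xs) = x" "0 < i + length xs"
    using funpow_of_rotate1[OF assms, of "i + length xs"] by auto
  then show "x \<in> {(g ^^ n) (hd xs) |n. 0 < n}" by blast
next
  fix x assume "x \<in> {(g ^^ n) (hd xs) |n. 0 < n}"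
  then show "x \<in> set xs" using funpow_of_rotate1[OF assms] assms by auto
qed

text \<open>The list consists of the iterates of \<open>g\<close> from \<open>u\<close> up to the
  return to \<open>u\<close> after \<open>d\<close> steps.\<close>

lemma rotate1_of_cyclic_on:
  assumes "cyclic_on g S" "finite S" "u \<in> S"
  obtains xs where "distinct (u # xs)" "set (u # xs) = S" "map g (u # xs) = rotate1 (u # xs)"
proof -
  define d where "d = funpow_dist1 g u u"
  define ys where "ys = map (\<lambda>i. (g ^^ i) u) [0..<d]"
  have S: "S = orbit g u" using assms by (auto simp: cyclic_on_alldef)
  with assms have u: "u \<in> orbit g u" by simp
  have "set ys = S"
    unfolding ys_def S d_def set_map set_upt by (rule orbit_conv_funpow_dist1[OF u, symmetric])
  moreover have "distinct ys"
    using inj_on_funpow_dist1[OF u] unfolding ys_def d_def distinct_map set_upt by simp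
  moreover have "map g ys = rotate1 ys"
  proof -
    have d: "(g ^^ d) u = u" unfolding d_def by (rule funpow_dist1_prop[OF u])
    have "g (ys ! i) = ys ! (Suc i mod d)" if "i < d" for i
    proof (cases "Suc i = d")
      case True
      then show ?thesis using d that by (auto simp: ys_def)
    qed (use that in \<open>simp add: ys_def\<close>)
    then show ?thesis unfolding map_rotate1_iff by (simp add: ys_def)
  qed
  moreover have "ys = u # tl ys"
  proof -
    have "0 < d" by (simp add: d_def)
    then have "[0..<d] = 0 # [1..<d]" by (simp add: upt_conv_Cons)
    then show ?thesis by (simp add: ys_def)
  qed
  ultimately show thesis using that[of "tl ys"] by simp
qed

text \<open>Once the starting neighbour is fixed, the entry at position \<open>i\<close> is its
  image under \<open>i\<close> rotations, and the length is the degree.\<close>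

lemma rot_list_unique:
  assumes "rot_list T v (u # xs)" "rot_list T v (u # ys)"
  shows "xs = ys"
proof -
  have "length (u # xs) = length (u # ys)"
    using assms unfolding rot_list_def by (metis distinct_card)
  moreover have "(u # xs) ! i = (u # ys) ! i" if "i < length (u # xs)" for i
    using assms funpow_of_rotate1[of "rot T v" "u # xs" i] funpow_of_rotate1[of "rot T v" "u # ys" i]
      that \<open>length (u # xs) = length (u # ys)\<close>
    by (simp add: rot_list_def del: length_Cons)
  ultimately have "u # xs = u # ys" by (intro nth_equalityI)
  then show ?thesis by simp
qed

lemma degree_rot_list: "rot_list T v xs \<Longrightarrow> degree T v = length xs"
  unfolding rot_list_def degree_def by (metis distinct_card)

text \<open>The parent fixes where the turn around the root starts, hence the ordered list of
  children; the subtrees follow by induction.\<close>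

lemma describes_unique:
  "describes T u s \<Longrightarrow> describes T u t \<Longrightarrow> label s = label t \<Longrightarrow> s = t"
proof (induction s arbitrary: u t)
  case (Node v ss)
  obtain ts where t: "t = Node v ts" using Node.prems by (cases t) auto
  have labels: "map label ss = map label ts"
    using Node.prems rot_list_unique by (auto simp: t describes_Node)
  have "length ss = length ts" using labels by (rule map_eq_imp_length_eq)
  then have "ss = ts"
  proof (rule nth_equalityI)
    fix i assume "i < length ss"
    then show "ss ! i = ts ! i"
      using Node.IH[of "ss ! i" v "ts ! i"] Node.prems labels \<open>length ss = length ts\<close>
      by (simp add: t describes_Node) (metis nth_map)
  qed
  then show ?case by (simp add: t)
qed

section \<open>Unfolding a tree from an arc\<close>

text \<open>When a new initial vertex already lies on the path, everything before that occurrence is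
  dropped.\<close>

lemma rtrancl_imp_distinct_path:
  assumes "(a, b) \<in> R\<^sup>*"
  obtains p where "p \<noteq> []" "hd p = a" "last p = b" "distinct p"
    "\<forall>i. Suc i < length p \<longrightarrow> (p ! i, p ! Suc i) \<in> R"
proof -
  have "\<exists>p. p \<noteq> [] \<and> hd p = a \<and> last p = b \<and> distinct p \<and>
      (\<forall>i. Suc i < length p \<longrightarrow> (p ! i, p ! Suc i) \<in> R)"
    using assms
  proof (induction rule: converse_rtrancl_induct)
    case base
    show ?case by (rule exI[of _ "[b]"]) auto
  next
    case (step x y)
    then obtain p where p: "p \<noteq> []" "hd p = y" "last p = b" "distinct p"
      "\<And>i. Suc i < length p \<Longrightarrow> (p ! i, p ! Suc i) \<in> R" by blast
    show ?case
    proof (cases "x \<in> set p")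
      case False
      have "((x # p) ! i, (x # p) ! Suc i) \<in> R" if "Suc i < length (x # p)" for i
        using that p step(1) by (cases i) (auto simp: hd_conv_nth)
      then show ?thesis using False p by (intro exI[of _ "x # p"]) auto
    next
      case True
      then obtain i where i: "i < length p" "p ! i = x" by (auto simp: in_set_conv_nth)
      have "(drop i p ! j, drop i p ! Suc j) \<in> R" if "Suc j < length (drop i p)" for j
        using that p(5)[of "i + j"] by simp
      then show ?thesis using i p by (intro exI[of _ "drop i p"]) (auto simp: hd_drop_conv_nth)
    qed
  qed
  then show thesis using that by blast
qed

text \<open>The graph with \<open>v\<close> deleted; in a tree its components, apart from
  \<open>v\<close> itself, are the branches at \<open>v\<close>.\<close>

definition avoiding :: "('v \<times> 'v) set \<Rightarrow> 'v \<Rightarrow> ('v \<times> 'v) set" where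
  "avoiding A v = {(x, y) \<in> A. x \<noteq> v \<and> y \<noteq> v}"

lemma sym_avoiding: "sym A \<Longrightarrow> sym (avoiding A v)"
  by (auto simp: avoiding_def sym_def)

text \<open>A path from \<open>a\<close> to \<open>b\<close> that misses \<open>v\<close> would
  close up through \<open>v\<close> to a cycle.\<close>

lemma separated_neighbours:
  assumes "\<nexists>vs. simple_cycle A vs" "sym A" "irrefl A"
    and "(v, a) \<in> A" "(v, b) \<in> A" "a \<noteq> b"
  shows "(a, b) \<notin> (avoiding A v)\<^sup>*"
proof
  assume "(a, b) \<in> (avoiding A v)\<^sup>*"
  then obtain p where p: "p \<noteq> []" "hd p = a" "last p = b" "distinct p"
    "\<forall>i. Suc i < length p \<longrightarrow> (p ! i, p ! Suc i) \<in> avoiding A v"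
    by (rule rtrancl_imp_distinct_path)
  have len: "2 \<le> length p"
    using p \<open>a \<noteq> b\<close> by (cases p; cases "tl p") auto
  \<comment> \<open>Since \<open>p\<close> has at least two vertices, each of them lies on an arc
    that avoids \<open>v\<close>.\<close>
  have "v \<notin> set p"
  proof
    assume "v \<in> set p"
    then obtain i where i: "i < length p" "p ! i = v" by (auto simp: in_set_conv_nth)
    show False
    proof (cases i)
      case 0
      then show ?thesis using p(5) len i by (auto simp: avoiding_def)
    next
      case (Suc j)
      then show ?thesis using p(5) i by (auto simp: avoiding_def)
    qed
  qed
  moreover have "((v # p) ! i, (v # p) ! Suc i) \<in> A" if "Suc i < length (v # p)" for i
    using that p assms(4) by (cases i) (auto simp: hd_conv_nth avoiding_def)
  ultimately have "simple_cycle A (v # p)"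
    using p len assms by (auto simp: simple_cycle_def dest: symD)
  then show False using assms(1) by blast
qed

locale rotation_tree =
  fixes T :: plane_graph
  assumes tree: "is_tree (verts T) (arcs T)"
    and cyclic: "v \<in> verts T \<Longrightarrow> cyclic_on (rot T v) (neighbours T v)"
begin

lemma sym_arcs: "sym (arcs T)" and irrefl_arcs: "irrefl (arcs T)"
  and finite_verts: "finite (verts T)" and arcs_subset: "arcs T \<subseteq> verts T \<times> verts T"
  and no_cycle: "\<nexists>vs. simple_cycle (arcs T) vs"
  and connected: "u \<in> verts T \<Longrightarrow> v \<in> verts T \<Longrightarrow> (u, v) \<in> (arcs T)\<^sup>*"
  using tree by (auto simp: is_tree_def)

lemma separated:
  "(v, a) \<in> arcs T \<Longrightarrow> (v, b) \<in> arcs T \<Longrightarrow> a \<noteq> b \<Longrightarrow> (a, b) \<notin> (avoiding (arcs T) v)\<^sup>*"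
  by (rule separated_neighbours[OF no_cycle sym_arcs irrefl_arcs])

text \<open>Induction on the size of the part of the tree beyond the arc \<open>(u, v)\<close>.\<close>

lemma describes_exists:
  "(u, v) \<in> arcs T \<Longrightarrow> \<exists>t. label t = v \<and> describes T u t"
proof (induction "card ((avoiding (arcs T) u)\<^sup>* `` {v})" arbitrary: u v rule: less_induct)
  case less
  let ?side = "\<lambda>u v. (avoiding (arcs T) u)\<^sup>* `` {v}"
  have uv: "u \<in> verts T" "v \<in> verts T" "(v, u) \<in> arcs T"
    using less.prems arcs_subset sym_arcs by (auto dest: symD)
  have "finite (neighbours T v)"
    by (rule finite_subset[OF _ finite_verts]) (use arcs_subset in \<open>auto simp: neighbours_def\<close>)
  then obtain ws where ws: "distinct (u # ws)" "set (u # ws) = neighbours T v"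
      "map (rot T v) (u # ws) = rotate1 (u # ws)"
    by (rule rotate1_of_cyclic_on[OF cyclic[OF uv(2)], of u]) (use uv in \<open>simp add: neighbours_def\<close>)
  have "\<exists>t. label t = w \<and> describes T v t" if "w \<in> set ws" for w
  proof (rule less.hyps)
    show vw: "(v, w) \<in> arcs T" using that ws by (auto simp: neighbours_def)
    have "w \<noteq> u" using that ws by auto
    have sep: "(w, u) \<notin> (avoiding (arcs T) v)\<^sup>*" using separated vw uv(3) \<open>w \<noteq> u\<close> by blast
    have "u \<noteq> v" "w \<noteq> v" using irrefl_arcs vw less.prems by (auto simp: irrefl_def)
    have first: "(v, w) \<in> (avoiding (arcs T) u)\<^sup>*"
      using vw \<open>w \<noteq> u\<close> \<open>u \<noteq> v\<close> by (auto simp: avoiding_def)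
    \<comment> \<open>By \<open>sep\<close> the branch beyond \<open>(v, w)\<close> never meets
      \<open>u\<close>, so its arcs avoid \<open>u\<close> too and it lies inside the branch beyond
      \<open>(u, v)\<close>. The inclusion is strict because of \<open>v\<close>.\<close>
    have "x \<in> ?side u v" if "(w, x) \<in> (avoiding (arcs T) v)\<^sup>*" for x
      using that
    proof (induction rule: rtrancl_induct)
      case base
      show ?case using first by simp
    next
      case (step y z)
      then have "(w, z) \<in> (avoiding (arcs T) v)\<^sup>*" by simp
      then have "(y, z) \<in> avoiding (arcs T) u"
        using step sep by (auto simp: avoiding_def)
      then show ?case using step by auto
    qed
    then have "?side v w \<subseteq> ?side u v" by auto
    moreover have "v \<in> ?side u v" by auto
    moreover have "v \<notin> ?side v w"
    proof
      assume "v \<in> ?side v w"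
      then have "(w, v) \<in> (avoiding (arcs T) v)\<^sup>*" by simp
      then show False
        by (rule rtranclE) (use \<open>w \<noteq> v\<close> in \<open>auto simp: avoiding_def\<close>)
    qed
    moreover have "finite (?side u v)"
    proof (rule finite_subset[OF _ finite_verts], clarsimp)
      fix x assume "(v, x) \<in> (avoiding (arcs T) u)\<^sup>*"
      then show "x \<in> verts T"
        by (rule rtranclE) (use uv arcs_subset in \<open>auto simp: avoiding_def\<close>)
    qed
    ultimately show "card (?side v w) < card (?side u v)"
      by (intro psubset_card_mono) auto
  qed
  then obtain g where g: "\<And>w. w \<in> set ws \<Longrightarrow> label (g w) = w \<and> describes T v (g w)"
    by metis
  then have "map label (map g ws) = ws" by (simp add: map_idI)
  then have "describes T u (Node v (map g ws))"
    using g ws unfolding describes_Node rot_list_def by (simp add: comp_def)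
  then show ?case by (intro exI[of _ "Node v (map g ws)"]) simp
qed

text \<open>Parent and child are joined by an arc, so the way down from the root stays inside the
  tree and misses every outside vertex. With \<open>w\<close> the parent of the root, this feeds
  \<open>separated\<close>.\<close>

lemma describes_connected:
  "describes T u t \<Longrightarrow> w \<notin> set_plane_tree t \<Longrightarrow> x \<in> set_plane_tree t \<Longrightarrow>
     (label t, x) \<in> (avoiding (arcs T) w)\<^sup>*"
proof (induction t arbitrary: u)
  case (Node v ts)
  show ?case
  proof (cases "x = v")
    case False
    then obtain t where t: "t \<in> set ts" "x \<in> set_plane_tree t" using Node.prems by auto
    then have "(label t, x) \<in> (avoiding (arcs T) w)\<^sup>*"
      using Node.IH[of t v] Node.prems by (auto simp: describes_Node)
    moreover have "(v, label t) \<in> avoiding (arcs T) w"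
      using Node.prems t label_in_set[of t]
      by (auto simp: describes_Node rot_list_def avoiding_def neighbours_def)
    ultimately show ?thesis by auto
  qed simp
qed

text \<open>If two subtrees of \<open>v\<close> shared a vertex, or one of them contained
  \<open>u\<close>, then two different neighbours of \<open>v\<close> would be connected without
  passing through \<open>v\<close>.\<close>

lemma describes_distinct:
  "describes T u t \<Longrightarrow> distinct (preorder t) \<and> u \<notin> set_plane_tree t"
proof (induction t arbitrary: u)
  case (Node v ts)
  have rl: "rot_list T v (u # map label ts)" and ds: "\<And>t. t \<in> set ts \<Longrightarrow> describes T v t"
    using Node.prems by (auto simp: describes_Node)
  then have IH: "distinct (preorder t)" "v \<notin> set_plane_tree t" if "t \<in> set ts" for t
    using Node.IH that by auto
  have arc: "(v, u) \<in> arcs T" "\<And>t. t \<in> set ts \<Longrightarrow> (v, label t) \<in> arcs T"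
    using rl by (auto simp: rot_list_def neighbours_def)
  have reach: "(label t, x) \<in> (avoiding (arcs T) v)\<^sup>*" if "t \<in> set ts" "x \<in> set_plane_tree t" for t x
    using describes_connected ds IH that by blast
  have "u \<notin> set_plane_tree t" if "t \<in> set ts" for t
    using separated[OF arc(2)[OF that] arc(1)] reach[OF that] rl that
    by (auto simp: rot_list_def)
  moreover have "u \<noteq> v" using arc irrefl_arcs by (auto simp: irrefl_def)
  moreover have "distinct (concat (map preorder us))"
    if "set us \<subseteq> set ts" "distinct (map label us)" for us
    using that
  proof (induction us)
    case (Cons s us)
    have "set_plane_tree s \<inter> set_plane_tree t = {}" if t: "t \<in> set us" for t
    proof (rule ccontr)
      assume "set_plane_tree s \<inter> set_plane_tree t \<noteq> {}"
      then obtain x where "x \<in> set_plane_tree s" "x \<in> set_plane_tree t" by auto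
      then have "(label s, x) \<in> (avoiding (arcs T) v)\<^sup>*" "(label t, x) \<in> (avoiding (arcs T) v)\<^sup>*"
        using reach Cons.prems t by auto
      then have "(label s, label t) \<in> (avoiding (arcs T) v)\<^sup>*"
        by (meson rtrancl_trans sym_avoiding sym_arcs sym_rtrancl symD)
      moreover have "label s \<noteq> label t" using Cons.prems t by auto
      ultimately show False using separated[OF arc(2) arc(2)] Cons.prems t by auto
    qed
    then show ?case using Cons IH by (auto simp: set_preorder)
  qed simp
  from this[of ts] have "distinct (concat (map preorder ts))"
    using rl by (simp add: rot_list_def)
  ultimately show ?case using IH by (auto simp: set_preorder)
qed

lemma describes_closed:
  "describes T u t \<Longrightarrow> v \<in> set_plane_tree t \<Longrightarrow> neighbours T v \<subseteq> insert u (set_plane_tree t)"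
proof (induction t arbitrary: u)
  case (Node w ts)
  show ?case
  proof (cases "v = w")
    case True
    then show ?thesis
      using Node.prems label_in_set by (force simp: describes_Node rot_list_def)
  next
    case False
    then obtain t where "t \<in> set ts" "v \<in> set_plane_tree t" using Node.prems by auto
    then show ?thesis using Node.IH[of t w] Node.prems by (auto simp: describes_Node)
  qed
qed

text \<open>The vertices of \<open>t\<close> together with \<open>r\<close> are closed under taking
  neighbours, and \<open>T\<close> is connected.\<close>

lemma describes_covers:
  assumes "describes T r t" "r \<in> verts T" "neighbours T r = {label t}"
  shows "verts T = insert r (set_plane_tree t)"
proof (intro equalityI subsetI)
  fix x assume "x \<in> verts T"
  then have "(r, x) \<in> (arcs T)\<^sup>*" using assms connected by blast
  then show "x \<in> insert r (set_plane_tree t)"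
  proof (induction rule: rtrancl_induct)
    case (step y z)
    then have "z \<in> neighbours T y" by (simp add: neighbours_def)
    then show ?case using step describes_closed[OF assms(1), of y] assms(3) label_in_set[of t] by auto
  qed simp
next
  have "set_plane_tree t \<subseteq> verts T" if "describes T u t" "u \<in> verts T" "(u, label t) \<in> arcs T" for u t
    using that
  proof (induction t arbitrary: u)
    case (Node v ts)
    then have "v \<in> verts T" using arcs_subset by auto
    have "(v, label t) \<in> arcs T" if "t \<in> set ts" for t
    proof -
      have "label t \<in> neighbours T v"
        using Node.prems that unfolding describes_Node rot_list_def by auto
      then show ?thesis by (simp add: neighbours_def)
    qed
    then have "set_plane_tree t \<subseteq> verts T" if "t \<in> set ts" for t
      using Node.IH[of t v] Node.prems \<open>v \<in> verts T\<close> that by (auto simp: describes_Node)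
    then show ?case using \<open>v \<in> verts T\<close> by auto
  qed
  moreover fix x assume "x \<in> insert r (set_plane_tree t)"
  ultimately show "x \<in> verts T" using assms by (auto simp: neighbours_def)
qed

end

section \<open>The plane graph of a labelled tree\<close>

text \<open>\<open>cycle_of_list\<close> turns a clockwise list into the permutation sending each
  entry to the next. At vertices outside the tree the rotation is unspecified.\<close>

definition graph_of :: "vertex \<Rightarrow> vertex plane_tree \<Rightarrow> plane_graph" where
  "graph_of r t = \<lparr>verts = insert r (set_plane_tree t),
     arcs = {(v, w). \<exists>xs. (v, xs) \<in> set (planted_adj r t) \<and> w \<in> set xs},
     rot = (\<lambda>v. cycle_of_list (the (map_of (planted_adj r t) v)))\<rparr>"

lemma map_fst_planted_adj: "map fst (planted_adj r t) = r # preorder t"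
  by (simp add: planted_adj_def map_fst_adj)

lemma root_in_adj: "(label t, u # map label (subtrees t)) \<in> set (adj u t)"
  by (cases t) simp

text \<open>The exceptional case is the edge from the root up to \<open>u\<close>, whose reverse is
  recorded only in \<open>planted_adj\<close>.\<close>

lemma adj_sym:
  "(v, xs) \<in> set (adj u t) \<Longrightarrow> w \<in> set xs \<Longrightarrow>
     v = label t \<and> w = u \<or> (\<exists>ys. (w, ys) \<in> set (adj u t) \<and> v \<in> set ys)"
proof (induction u t rule: adj.induct)
  case (1 u x ts)
  show ?case
  proof (cases "(v, xs) = (x, u # map label ts)")
    case True
    show ?thesis
    proof (cases "w = u")
      case False
      then obtain s where s: "s \<in> set ts" "w = label s" using True 1 by auto
      then have "(w, x # map label (subtrees s)) \<in> set (adj u (Node x ts))"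
        using root_in_adj[of s x] by auto
      then show ?thesis using True by (intro disjI2 exI[of _ "x # map label (subtrees s)"]) auto
    qed (use True in simp)
  next
    case False
    then obtain s where s: "s \<in> set ts" "(v, xs) \<in> set (adj x s)" using 1 by auto
    from 1(1)[OF s 1(3)] show ?thesis
    proof (elim disjE exE conjE)
      assume "v = label s" "w = x"
      then have "(w, u # map label ts) \<in> set (adj u (Node x ts))" "v \<in> set (u # map label ts)"
        using s by auto
      then show ?thesis by blast
    next
      fix ys assume "(w, ys) \<in> set (adj x s)" "v \<in> set ys"
      then have "(w, ys) \<in> set (adj u (Node x ts))" using s by auto
      then show ?thesis using \<open>v \<in> set ys\<close> by blast
    qed
  qed
qed

lemma adj_distinct:
  "distinct (preorder t) \<Longrightarrow> u \<notin> set_plane_tree t \<Longrightarrow> (v, xs) \<in> set (adj u t) \<Longrightarrow> distinct xs"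
proof (induction u t rule: adj.induct)
  case (1 u x ts)
  have d: "distinct (concat (map preorder ts))" using 1 by simp
  have "distinct (map label us)" if "distinct (concat (map preorder us))" for us :: "'a plane_tree list"
    using that
  proof (induction us)
    case (Cons s us)
    have "label s \<noteq> label u" if "u \<in> set us" for u
      using Cons.prems that label_in_set[of s] label_in_set[of u] by (auto simp: set_preorder)
    then show ?case using Cons by auto
  qed simp
  then have dl: "distinct (map label ts)" using d by blast
  have "label s \<noteq> u" if "s \<in> set ts" for s
    using that 1 label_in_set[of s] by auto
  then have "distinct (u # map label ts)" using dl by auto
  moreover have "distinct (preorder s) \<and> x \<notin> set_plane_tree s" if "s \<in> set ts" for s
    using that 1 d by (auto simp: distinct_concat_iff set_preorder)
  ultimately show ?case using 1 by auto
qed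

text \<open>Applied to a preorder, this gives a numbering in which parents come before their
  children.\<close>

lemma exists_rank:
  "distinct xs \<Longrightarrow> \<exists>rk :: 'v \<Rightarrow> nat. sorted_wrt (\<lambda>x y. rk x < rk y) xs"
proof (induction xs)
  case (Cons a xs)
  then obtain rk :: "'v \<Rightarrow> nat" where rk: "sorted_wrt (\<lambda>x y. rk x < rk y) xs" by auto
  let ?rk = "\<lambda>x. if x = a then 0 else Suc (rk x)"
  have "sorted_wrt (\<lambda>x y. ?rk x < ?rk y) xs"
    using rk Cons.prems by (auto elim!: sorted_wrt_mono_rel[rotated])
  then have "sorted_wrt (\<lambda>x y. ?rk x < ?rk y) (a # xs)" using Cons.prems by auto
  then show ?case by (intro exI[of _ ?rk])
qed auto

lemma sorted_wrt_concatD: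
  "sorted_wrt P (concat xss) \<Longrightarrow> xs \<in> set xss \<Longrightarrow> sorted_wrt P xs"
  by (induction xss) (auto simp: sorted_wrt_append)

text \<open>Here \<open>hd xs\<close> is the parent of \<open>v\<close> and \<open>tl xs\<close>
  lists its children, which come later in preorder.\<close>

lemma adj_rank:
  assumes "sorted_wrt (\<lambda>x y. rk x < (rk y :: nat)) (u # preorder t)" "(v, xs) \<in> set (adj u t)"
  shows "rk (hd xs) < rk v \<and> (\<forall>w\<in>set (tl xs). rk v < rk w)"
  using assms
proof (induction u t rule: adj.induct)
  case (1 u x ts)
  have "sorted_wrt (\<lambda>x y. rk x < rk y) (x # preorder s)" if "s \<in> set ts" for s
    using 1 that sorted_wrt_concatD[of _ "map preorder ts" "preorder s"] by auto
  moreover have "rk x < rk (label s)" if "s \<in> set ts" for s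
    using 1 that label_in_set[of s] by (auto simp: set_preorder)
  ultimately show ?case using 1 by auto
qed

text \<open>A vertex of maximal rank on a cycle would have two neighbours of no larger rank.\<close>

lemma no_simple_cycle_rank:
  fixes rk :: "'v \<Rightarrow> nat"
  assumes sym: "sym A"
    and parent: "\<And>v a b. (v, a) \<in> A \<Longrightarrow> (v, b) \<in> A \<Longrightarrow> rk a \<le> rk v \<Longrightarrow> rk b \<le> rk v \<Longrightarrow> a = b"
  shows "\<nexists>vs. simple_cycle A vs"
proof
  assume "\<exists>vs. simple_cycle A vs"
  then obtain vs where len: "3 \<le> length vs" and d: "distinct vs"
    and path: "\<And>i. Suc i < length vs \<Longrightarrow> (vs ! i, vs ! Suc i) \<in> A" and close: "(last vs, hd vs) \<in> A"
    by (auto simp: simple_cycle_def)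
  let ?n = "length vs"
  have step: "(vs ! i, vs ! (Suc i mod ?n)) \<in> A" if "i < ?n" for i
  proof (cases "Suc i = ?n")
    case True
    then have "i = ?n - 1" "vs \<noteq> []" using len by auto
    then have "last vs = vs ! i" "hd vs = vs ! 0" by (simp_all add: last_conv_nth hd_conv_nth)
    then show ?thesis using close True by simp
  qed (use path that in simp)
  have "finite (rk ` set vs)" "rk ` set vs \<noteq> {}" using len by auto
  then have "Max (rk ` set vs) \<in> rk ` set vs" by (rule Max_in)
  then obtain m where m: "m \<in> set vs" "Max (rk ` set vs) = rk m" by auto
  then have max: "rk x \<le> rk m" if "x \<in> set vs" for x
    using that by (metis Max_ge List.finite_set finite_imageI imageI)
  obtain i where i: "i < ?n" "vs ! i = m" using m(1) by (auto simp: in_set_conv_nth)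
  define j where "j = (if i = 0 then ?n - 1 else i - 1)"
  have j: "j < ?n" "Suc j mod ?n = i" using i len by (auto simp: j_def)
  have "(m, vs ! j) \<in> A" using step[OF j(1)] j i sym by (auto dest: symD)
  moreover have "(m, vs ! (Suc i mod ?n)) \<in> A" using step[OF i(1)] i by simp
  moreover have "Suc i mod ?n < ?n" using len by (intro mod_less_divisor) auto
  ultimately have "vs ! j = vs ! (Suc i mod ?n)"
    using parent[of m] max j(1) by (meson nth_mem)
  \<comment> \<open>The predecessor and the successor of \<open>m\<close> on the cycle coincide,
    which is impossible for at least three distinct vertices.\<close>
  then have "j = Suc i mod ?n"
    using d j \<open>Suc i mod ?n < ?n\<close> by (simp add: nth_eq_iff_index_eq)
  then show False using i len by (auto simp: j_def mod_Suc split: if_splits)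
qed

context
  fixes r :: vertex and t :: "vertex plane_tree"
  assumes distinct: "distinct (r # preorder t)"
begin

lemma planted_adj_unique:
  "(v, xs) \<in> set (planted_adj r t) \<Longrightarrow> (v, ys) \<in> set (planted_adj r t) \<Longrightarrow> xs = ys"
  using distinct by (auto simp flip: map_fst_planted_adj dest: eq_key_imp_eq_value)

lemma planted_adj_sym:
  assumes "(v, xs) \<in> set (planted_adj r t)" "w \<in> set xs"
  shows "\<exists>ys. (w, ys) \<in> set (planted_adj r t) \<and> v \<in> set ys"
proof (cases "(v, xs) = (r, [label t])")
  case True
  then have "w = label t" "v = r" using assms by auto
  then show ?thesis using root_in_adj[of t r] by (fastforce simp: planted_adj_def)
next
  case False
  then show ?thesis
    using assms adj_sym[of v xs r t w] by (fastforce simp: planted_adj_def)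
qed

lemma rot_list_graph_of:
  assumes vxs: "(v, xs) \<in> set (planted_adj r t)"
  shows "rot_list (graph_of r t) v xs"
  unfolding rot_list_def
proof (intro conjI)
  show d: "distinct xs"
    using vxs distinct adj_distinct[of t r v xs] by (auto simp: planted_adj_def set_preorder)
  show "set xs = neighbours (graph_of r t) v"
    using vxs planted_adj_unique by (auto simp: neighbours_def graph_of_def)
  have "map_of (planted_adj r t) v = Some xs"
    using vxs distinct by (simp add: map_fst_planted_adj)
  then show "map (rot (graph_of r t) v) xs = rotate1 xs"
    using cyclic_rotation[OF d, of 1] by (simp add: graph_of_def)
qed

lemma verts_graph_of: "verts (graph_of r t) = fst ` set (planted_adj r t)"
  unfolding set_map[symmetric] map_fst_planted_adj by (simp add: graph_of_def set_preorder)

text \<open>Every vertex is reached from \<open>r\<close> downwards, and a rank that increases along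
  the preorder rules out cycles.\<close>

lemma is_tree_graph_of: "is_tree (verts (graph_of r t)) (arcs (graph_of r t))"
proof -
  let ?A = "arcs (graph_of r t)"
  have A: "(v, w) \<in> ?A \<longleftrightarrow> (\<exists>xs. (v, xs) \<in> set (planted_adj r t) \<and> w \<in> set xs)" for v w
    by (simp add: graph_of_def)
  have sym: "sym ?A" using planted_adj_sym by (auto simp: sym_def A)
  obtain rk :: "vertex \<Rightarrow> nat" where rk: "sorted_wrt (\<lambda>x y. rk x < rk y) (r # preorder t)"
    using exists_rank[OF distinct] by blast
  have cases: "(v = r \<and> w = label t) \<or>
      (\<exists>xs. (v, xs) \<in> set (adj r t) \<and> w \<in> set xs \<and> rk (hd xs) < rk v \<and> (w = hd xs \<or> rk v < rk w))"
    if "(v, w) \<in> ?A" for v w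
  proof -
    from that[unfolded A] obtain xs where xs: "(v, xs) \<in> set (planted_adj r t)" "w \<in> set xs"
      by blast
    show ?thesis
    proof (cases "(v, xs) = (r, [label t])")
      case False
      then have "(v, xs) \<in> set (adj r t)" using xs by (auto simp: planted_adj_def)
      with adj_rank[OF rk this] xs show ?thesis by (cases xs) auto
    qed (use xs in auto)
  qed
  have r: "r \<noteq> v" if "(v, xs) \<in> set (adj r t)" for v xs
  proof -
    have "v \<in> set (map fst (adj r t))" using that by force
    then have "v \<in> set (preorder t)" unfolding map_fst_adj .
    then show ?thesis using distinct by auto
  qed
  have "\<nexists>vs. simple_cycle ?A vs"
  proof (rule no_simple_cycle_rank[OF sym, of rk])
    \<comment> \<open>A neighbour of no larger rank must be the parent. The vertex \<open>r\<close>
      has no parent, but it has only one neighbour, so uniqueness holds there as well.\<close>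
    have parent: "v = r \<and> w = label t \<or> (\<exists>xs. (v, xs) \<in> set (adj r t) \<and> w = hd xs)"
      if "(v, w) \<in> ?A" "rk w \<le> rk v" for v w
      using cases[OF that(1)] that(2) by (metis not_le)
    have unique: "xs = ys" if "(v, xs) \<in> set (adj r t)" "(v, ys) \<in> set (adj r t)" for v xs ys
      using planted_adj_unique[of v xs ys] that by (simp add: planted_adj_def)
    fix v a b assume "(v, a) \<in> ?A" "(v, b) \<in> ?A" "rk a \<le> rk v" "rk b \<le> rk v"
    then show "a = b"
      using parent[of v a] parent[of v b] r unique by metis
  qed
  moreover have "irrefl ?A"
  proof (rule irreflI)
    fix v show "(v, v) \<notin> ?A"
      using cases[of v v] distinct label_in_set[of t] by (auto simp: set_preorder)
  qed
  moreover have "?A \<subseteq> verts (graph_of r t) \<times> verts (graph_of r t)"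
    using planted_adj_sym by (force simp: verts_graph_of A)
  moreover have "(r, v) \<in> ?A\<^sup>*" if v: "v \<in> verts (graph_of r t)" for v
  proof (cases "v = r")
    case False
    have "(label s, x) \<in> ?A\<^sup>*" if "set (adj u s) \<subseteq> set (adj r t)" "x \<in> set_plane_tree s" for u s x
      using that
    proof (induction s arbitrary: u)
      case (Node y ss)
      show ?case
      proof (cases "x = y")
        case False
        then obtain s where s: "s \<in> set ss" "x \<in> set_plane_tree s" using Node.prems by auto
        then have "(label s, x) \<in> ?A\<^sup>*" using Node.IH[of s y] Node.prems by auto
        moreover have "(y, label s) \<in> ?A"
          using s Node.prems by (auto simp: A planted_adj_def)
        ultimately show ?thesis by auto
      qed simp
    qed
    from this[of r t v] have "(label t, v) \<in> ?A\<^sup>*" using v False by (simp add: graph_of_def)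
    moreover have "(r, label t) \<in> ?A" by (auto simp: A planted_adj_def)
    ultimately show ?thesis by auto
  qed simp
  then have "(u, v) \<in> ?A\<^sup>*" if "u \<in> verts (graph_of r t)" "v \<in> verts (graph_of r t)" for u v
    using that sym by (meson rtrancl_trans sym_rtrancl symD)
  moreover have "finite (verts (graph_of r t))" "verts (graph_of r t) \<noteq> {}"
    by (simp_all add: verts_graph_of planted_adj_def)
  ultimately show ?thesis using sym unfolding is_tree_def by blast
qed

end

section \<open>The contour of a tree\<close>

text \<open>A step is allowed only on arrival at an internal vertex, so that walks cannot continue
  past a boundary vertex; this is the stopping rule of \<open>next_boundary\<close>.\<close>

definition contour_step :: "plane_graph \<Rightarrow> ((vertex \<times> vertex) \<times> (vertex \<times> vertex)) set" where
  "contour_step T = {(a, contour T a) |a. snd a \<in> internal_vertices T}"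

fun leaf_arcs :: "'v \<Rightarrow> 'v plane_tree \<Rightarrow> ('v \<times> 'v) list" where
  "leaf_arcs u (Node v ts) = (if ts = [] then [(u, v)] else concat (map (leaf_arcs v) ts))"

text \<open>\<open>tour T a ls c\<close>: the contour walk from \<open>a\<close> to \<open>c\<close>, which turns round at a leaf, enters leaves
  exactly along the arcs \<open>ls\<close>, in this order.\<close>

fun tour :: "plane_graph \<Rightarrow> vertex \<times> vertex \<Rightarrow> (vertex \<times> vertex) list \<Rightarrow> vertex \<times> vertex \<Rightarrow> bool" where
  "tour T a [] c \<longleftrightarrow> (a, c) \<in> (contour_step T)\<^sup>*"
| "tour T a (l # ls) c \<longleftrightarrow> (a, l) \<in> (contour_step T)\<^sup>* \<and> tour T (prod.swap l) ls c"

lemma map_snd_leaf_arcs: "map snd (leaf_arcs u t) = leaves t"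
  by (induction u t rule: leaf_arcs.induct)
    (auto simp: map_concat comp_def intro!: arg_cong[where f = concat])

lemma leaf_arcs_adj: "(p, b) \<in> set (leaf_arcs u t) \<Longrightarrow> (b, [p]) \<in> set (adj u t)"
  by (induction u t rule: leaf_arcs.induct) (auto split: if_splits)

lemma tour_step: "(a, b) \<in> (contour_step T)\<^sup>* \<Longrightarrow> tour T b ls c \<Longrightarrow> tour T a ls c"
  by (cases ls) auto

lemma tour_append: "tour T a ls b \<Longrightarrow> tour T b ms c \<Longrightarrow> tour T a (ls @ ms) c"
  by (induction ls arbitrary: a) (auto intro: tour_step)

text \<open>Arriving from \<open>u\<close>, the rotation leads to the leftmost child; after the walk
  round each child it leads to the next one, and after the last child back to
  \<open>u\<close>.\<close>

lemma tour_describes: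
  assumes "describes T u t"
    and "\<forall>(v, xs)\<in>set (adj u t). tl xs \<noteq> [] \<longrightarrow> v \<in> internal_vertices T"
  shows "tour T (u, label t) (leaf_arcs u t) (label t, u)"
  using assms
proof (induction t arbitrary: u)
  case (Node v ts)
  show ?case
  proof (cases "ts = []")
    case False
    then have int: "v \<in> internal_vertices T" using Node.prems by auto
    then have step: "((x, v), (v, rot T v x)) \<in> contour_step T" for x
      by (force simp: contour_step_def)
    have IH: "tour T (v, label s) (leaf_arcs v s) (label s, v)" if "s \<in> set ts" for s
      using Node that by (fastforce simp: describes_Node)
    have rot: "map (rot T v) (u # map label ts) = map label ts @ [u]"
      using Node.prems by (simp add: describes_Node rot_list_def)
    \<comment> \<open>The claim is generalized to the children \<open>us\<close> still to be
      visited: the second premise says that the rotation leads from each of them to the next and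
      from the last to \<open>u\<close>.\<close>
    have "tour T (v, hd (map label us @ [u])) (concat (map (leaf_arcs v) us)) (v, u)"
      if "set us \<subseteq> set ts" "map (rot T v) (map label us) = tl (map label us @ [u])" for us
      using that
    proof (induction us)
      case (Cons s us)
      have "map (rot T v) (map label us) = tl (map label us @ [u])"
        using Cons.prems(2) by (cases us) auto
      then have "tour T (v, hd (map label us @ [u])) (concat (map (leaf_arcs v) us)) (v, u)"
        using Cons by simp
      moreover have "rot T v (label s) = hd (map label us @ [u])"
        using Cons.prems(2) by (cases us) auto
      ultimately have "tour T (label s, v) (concat (map (leaf_arcs v) us)) (v, u)"
        using step[of "label s"] by (auto intro: tour_step)
      then show ?case using Cons.prems IH[of s] by (auto intro: tour_append)
    qed simp
    from this[of ts] have "tour T (v, rot T v u) (leaf_arcs u (Node v ts)) (v, u)"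
      using rot False by (cases ts) auto
    then show ?thesis using step[of u] by (auto intro: tour_step)
  qed simp
qed

lemma next_boundary_of_steps:
  assumes "((b, u), (p, b')) \<in> (contour_step T)\<^sup>*" "(b, u) \<in> arcs T" "b' \<in> boundary_vertices T"
  shows "next_boundary T b b'"
proof -
  have "\<exists>m. (contour T ^^ m) a = c \<and> (\<forall>j<m. snd ((contour T ^^ j) a) \<in> internal_vertices T)"
    if "(a, c) \<in> (contour_step T)\<^sup>*" for a c
    using that
  proof (induction rule: rtrancl_induct)
    case base
    show ?case by (rule exI[of _ 0]) simp
  next
    case (step y z)
    then obtain m where "(contour T ^^ m) a = y"
      "\<forall>j<m. snd ((contour T ^^ j) a) \<in> internal_vertices T" by blast
    then show ?case
      using step by (intro exI[of _ "Suc m"]) (auto simp: contour_step_def less_Suc_eq)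
  qed
  from this[OF assms(1)] obtain m where "(contour T ^^ m) (b, u) = (p, b')"
    "\<forall>j<m. snd ((contour T ^^ j) (b, u)) \<in> internal_vertices T" by blast
  with assms(2,3) show ?thesis
    unfolding next_boundary_def by (intro exI[of _ u] exI[of _ m]) auto
qed

text \<open>Between two consecutive leaves the walk passes internal vertices only, and it leaves
  each leaf by the reverse of the arc of arrival.\<close>

lemma tour_successively:
  assumes "tour T (b, p) ls (q, c)" "(b, p) \<in> arcs T" "c \<in> boundary_vertices T"
    and "\<forall>(p, b)\<in>set ls. b \<in> boundary_vertices T \<and> (b, p) \<in> arcs T"
  shows "successively (next_boundary T) (b # map snd ls @ [c])"
  using assms
proof (induction ls arbitrary: b p)
  case (Cons l ls)
  then show ?case
    using next_boundary_of_steps[of b p "fst l" "snd l" T] by (cases l) auto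
qed (auto intro: next_boundary_of_steps)

lemma boundary_not_internal: "v \<in> boundary_vertices T \<Longrightarrow> v \<notin> internal_vertices T"
  by (auto simp: boundary_vertices_def internal_vertices_def)

text \<open>Only one arc leaves \<open>b\<close>, so both walks agree, and each stops when it meets
  the boundary for the first time.\<close>

lemma next_boundary_unique:
  assumes "degree T b = 1" "next_boundary T b c" "next_boundary T b d"
  shows "c = d"
proof -
  obtain u m v k where u: "(b, u) \<in> arcs T" "c \<in> boundary_vertices T"
      "snd ((contour T ^^ m) (b, u)) = c"
      "\<forall>j<m. snd ((contour T ^^ j) (b, u)) \<in> internal_vertices T"
    and v: "(b, v) \<in> arcs T" "d \<in> boundary_vertices T"
      "snd ((contour T ^^ k) (b, v)) = d"
      "\<forall>j<k. snd ((contour T ^^ j) (b, v)) \<in> internal_vertices T"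
    using assms unfolding next_boundary_def by blast
  obtain x where "neighbours T b = {x}"
    using assms(1) unfolding degree_def by (auto simp: card_1_singleton_iff)
  moreover have "u \<in> neighbours T b" "v \<in> neighbours T b" using u v by (simp_all add: neighbours_def)
  ultimately have "u = v" by simp
  then have "m = k" using u v boundary_not_internal by (metis linorder_neqE_nat)
  then show ?thesis using u v \<open>u = v\<close> by simp
qed

section \<open>Trees represented by labelled plane trees\<close>

lemma adj_ne: "(v, xs) \<in> set (adj u t) \<Longrightarrow> xs \<noteq> []"
  by (induction u t rule: adj.induct) auto

lemma reduced_iff_adj: "reduced t \<longleftrightarrow> (\<forall>(v, xs)\<in>set (adj u t). length xs \<noteq> 2)"
  by (induction u t rule: adj.induct) auto

lemma set_leaves: "set (leaves t) = {v. \<exists>p. (v, [p]) \<in> set (adj u t)}"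
proof (induction u t rule: adj.induct)
  case (1 u v ts)
  then show ?case by (cases "ts = []") auto
qed

lemma tree_weight_adj:
  "tree_weight f t = prod_list (map (\<lambda>(v, xs). if tl xs = [] then 1 else f (length xs)) (adj u t))"
proof (induction u t rule: adj.induct)
  case (1 u v ts)
  let ?g = "\<lambda>(v, xs). if tl xs = [] then 1 else f (length xs)"
  have "prod_list (map ?g (concat (map (adj v) us))) = prod_list (map (tree_weight f) us)"
    if "set us \<subseteq> set ts" for us
    using that by (induction us) (auto simp: 1)
  from this[of ts] show ?case by simp
qed

lemma adj_map:
  "adj (g u) (map_plane_tree g t) = map (map_prod g (map g)) (adj u t)"
proof (induction u t rule: adj.induct)
  case (1 u v ts)
  have "label (map_plane_tree g s) = g (label s)" for s by (cases s) simp
  then show ?case using 1 by (auto simp: map_concat comp_def intro!: arg_cong[where f = concat])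
qed

lemma label_map: "label (map_plane_tree g t) = g (label t)"
  by (cases t) simp

lemma planted_adj_map:
  "planted_adj (g r) (map_plane_tree g t) = map (map_prod g (map g)) (planted_adj r t)"
  by (simp add: planted_adj_def adj_map label_map)

lemma preorder_map: "preorder (map_plane_tree g t) = map g (preorder t)"
  by (induction t) (auto simp: map_concat intro!: arg_cong[where f = concat])

text \<open>Shape and preorder together determine a tree: equal shapes cut the two preorders into
  blocks of equal lengths.\<close>

lemma map_plane_tree_of_preorder:
  "map_plane_tree (\<lambda>_. ()) s = map_plane_tree (\<lambda>_. ()) t \<Longrightarrow>
    map g (preorder s) = preorder t \<Longrightarrow> map_plane_tree g s = t"
proof (induction s arbitrary: t)
  case (Node v ss)
  obtain ts where t: "t = Node (g v) ts" using Node.prems by (cases t) auto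
  have "map (map_plane_tree g) us = ws"
    if "set us \<subseteq> set ss" "map (map_plane_tree (\<lambda>_. ())) us = map (map_plane_tree (\<lambda>_. ())) ws"
      "map g (concat (map preorder us)) = concat (map preorder ws)" for us ws
    using that
  proof (induction us arbitrary: ws)
    case (Cons u us)
    then obtain w ws' where ws: "ws = w # ws'"
      "map_plane_tree (\<lambda>_. ()) u = map_plane_tree (\<lambda>_. ()) w"
      "map (map_plane_tree (\<lambda>_. ())) us = map (map_plane_tree (\<lambda>_. ())) ws'"
      by auto
    have "length (preorder u) = length (preorder w)"
      using arg_cong[OF ws(2), of "\<lambda>t. length (preorder t)"] by (simp only: preorder_map length_map)
    then have "map g (preorder u) = preorder w"
      "map g (concat (map preorder us)) = concat (map preorder ws')"
      using Cons.prems(3) ws by auto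
    then show ?case using Cons Node.IH[of u w] ws by simp
  qed simp
  from this[of ss ts] show ?case using Node.prems by (simp add: t)
qed

lemma exists_map:
  "distinct xs \<Longrightarrow> length xs = length ys \<Longrightarrow> \<exists>g. map g xs = ys"
proof (induction xs arbitrary: ys)
  case (Cons x xs)
  then obtain y ys' where ys: "ys = y # ys'" "length xs = length ys'" by (cases ys) auto
  then obtain g where "map g xs = ys'" using Cons by auto
  then have "map (g(x := y)) (x # xs) = ys" using Cons.prems ys by auto
  then show ?case by (intro exI[of _ "g(x := y)"])
qed simp

text \<open>The tree \<open>t\<close> is \<open>T\<close> rooted at its leaf \<open>n\<close>. The
  condition \<open>tl xs = []\<close> means a single neighbour, so boundary vertices are
  \<open>Boundary n\<close> and the leaves of \<open>t\<close>; their prescribed order encodes the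
  clockwise labelling.\<close>

definition represents :: "nat \<Rightarrow> plane_graph \<Rightarrow> vertex plane_tree \<Rightarrow> bool" where
  "represents n T t \<longleftrightarrow>
     distinct (Boundary n # preorder t) \<and> verts T = insert (Boundary n) (set_plane_tree t) \<and>
     (\<forall>(v, xs)\<in>set (planted_adj (Boundary n) t).
        rot_list T v xs \<and> (v \<in> range Internal \<longleftrightarrow> tl xs \<noteq> [])) \<and>
     leaves t = map Boundary [1..<n] \<and> reduced t"

lemma representsD:
  assumes "represents n T t"
  shows "distinct (Boundary n # preorder t)"
    and "verts T = set (Boundary n # preorder t)"
    and "verts T = fst ` set (planted_adj (Boundary n) t)"
    and "(v, xs) \<in> set (planted_adj (Boundary n) t) \<Longrightarrow> rot_list T v xs"
    and "(v, xs) \<in> set (planted_adj (Boundary n) t) \<Longrightarrow> v \<in> range Internal \<longleftrightarrow> tl xs \<noteq> []"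
    and "(v, xs) \<in> set (planted_adj (Boundary n) t) \<Longrightarrow> v \<in> range Boundary \<longleftrightarrow> tl xs = []"
    and "leaves t = map Boundary [1..<n]" "reduced t"
    and "describes T (Boundary n) t"
proof -
  show "distinct (Boundary n # preorder t)" "leaves t = map Boundary [1..<n]" "reduced t"
    and verts: "verts T = set (Boundary n # preorder t)"
    and rl: "(v, xs) \<in> set (planted_adj (Boundary n) t) \<Longrightarrow> rot_list T v xs"
    and int: "(v, xs) \<in> set (planted_adj (Boundary n) t) \<Longrightarrow> v \<in> range Internal \<longleftrightarrow> tl xs \<noteq> []" for v xs
    using assms by (auto simp: represents_def set_preorder)
  show "(v, xs) \<in> set (planted_adj (Boundary n) t) \<Longrightarrow> v \<in> range Boundary \<longleftrightarrow> tl xs = []"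
    using int[of v xs] by (cases v) auto
  show "verts T = fst ` set (planted_adj (Boundary n) t)"
    unfolding verts map_fst_planted_adj[symmetric] by simp
  show "describes T (Boundary n) t"
    using rl by (auto simp: describes_def planted_adj_def)
qed

text \<open>From \<open>n\<close> the successor is 1, and from then on labels grow by one. The label
  \<open>n\<close> does not recur within \<open>ls\<close>, so only the length remains to be found,
  and distinctness gives \<open>n - 1\<close>.\<close>

lemma leaves_eq_upt:
  assumes step: "\<And>i c. i \<in> {1..n} \<Longrightarrow> P (Boundary i) c \<Longrightarrow> c = Boundary (if i = n then 1 else Suc i)"
    and succ: "successively P (Boundary n # ls)" and "distinct ls"
    and set: "set ls = Boundary ` {1..<n}" and "2 \<le> n"
  shows "ls = map Boundary [1..<n]"
proof -
  have run: "xs = map Boundary [Suc i..<Suc i + length xs]"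
    if "successively P (Boundary i # xs)" "1 \<le> i" "i < n" "Boundary n \<notin> set xs" for i xs
    using that
  proof (induction xs arbitrary: i)
    case (Cons x xs)
    have x: "x = Boundary (Suc i)" using step[of i x] Cons.prems by auto
    then have "Suc i < n" using Cons.prems by (cases "Suc i = n") auto
    then have "xs = map Boundary [Suc (Suc i)..<Suc (Suc i) + length xs]"
      using Cons.prems Cons.IH[of "Suc i"] x by auto
    moreover have "[Suc i..<Suc i + length (x # xs)] = Suc i # [Suc (Suc i)..<Suc (Suc i) + length xs]"
      by (subst upt_conv_Cons) (simp_all del: upt_Suc)
    ultimately show ?case using x by (metis list.simps(9))
  qed simp
  obtain x xs where ls: "ls = x # xs" using set \<open>2 \<le> n\<close> by (cases ls) auto
  then have "x = Boundary 1" using step[of n x] succ \<open>2 \<le> n\<close> by auto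
  moreover have "Boundary n \<notin> set ls" unfolding set by auto
  then have "xs = map Boundary [Suc 1..<Suc 1 + length xs]"
    using succ ls \<open>x = Boundary 1\<close> \<open>2 \<le> n\<close> by (intro run) auto
  moreover have len: "length ls = n - 1"
  proof -
    have "length ls = card (Boundary ` {1..<n})"
      using distinct_card[OF \<open>distinct ls\<close>] set by simp
    then show ?thesis by (simp add: card_image inj_on_def)
  qed
  moreover have "[1..<n] = 1 # [Suc 1..<n]" using \<open>2 \<le> n\<close> by (simp add: upt_conv_Cons)
  moreover have "Suc 1 + length xs = n" using len ls \<open>2 \<le> n\<close> by simp
  ultimately show ?thesis using ls by (metis list.simps(9))
qed

text \<open>Leaf \<open>n\<close> has a single arc, and \<open>T\<close> is unfolded along it;
  degrees tell leaves from internal vertices, and the contour fixes the order of the leaves.\<close>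

lemma exists_representation:
  assumes T: "T \<in> reduced_trees n" and n: "3 \<le> n"
  obtains t where "represents n T t"
proof -
  have planar: "planar_tree n T" and no2: "\<And>v. v \<in> internal_vertices T \<Longrightarrow> degree T v \<noteq> 2"
    and no1: "\<And>v. v \<in> internal_vertices T \<Longrightarrow> degree T v \<noteq> 1"
    using T n by (auto simp: reduced_trees_def series_reduced_def)
  then interpret rotation_tree T
    by unfold_locales (auto simp: planar_tree_def)
  let ?r = "Boundary n"
  have bd: "boundary_vertices T = Boundary ` {1..n}"
    and deg1: "\<And>b. b \<in> boundary_vertices T \<Longrightarrow> degree T b = 1"
    and nb: "\<And>i. i \<in> {1..n} \<Longrightarrow> next_boundary T (Boundary i) (Boundary (if i = n then 1 else Suc i))"
    using planar by (auto simp: planar_tree_def)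
  have r: "?r \<in> boundary_vertices T" "?r \<in> verts T"
  proof -
    show "?r \<in> boundary_vertices T" using n by (simp add: bd)
    then show "?r \<in> verts T" by (simp add: boundary_vertices_def)
  qed
  then obtain u0 where u0: "neighbours T ?r = {u0}"
    using deg1 unfolding degree_def by (metis card_1_singletonE)
  then have "(?r, u0) \<in> arcs T" by (auto simp: neighbours_def)
  then obtain t where t: "label t = u0" "describes T ?r t" using describes_exists by blast
  have distinct: "distinct (?r # preorder t)"
    using describes_distinct[OF t(2)] by (simp add: set_preorder)
  have verts: "verts T = insert ?r (set_plane_tree t)"
    using describes_covers[OF t(2) r(2)] u0 t by simp
  have "rot T ?r u0 \<in> neighbours T ?r"
    using cyclic_on_funpow_in[OF cyclic[OF r(2)], of u0 1] u0 by simp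
  then have rot_r: "rot_list T ?r [u0]" using u0 by (simp add: rot_list_def)
  have rl: "rot_list T v xs" if "(v, xs) \<in> set (planted_adj ?r t)" for v xs
    using that rot_r t by (auto simp: planted_adj_def describes_def)
  have xs_ne: "xs \<noteq> []" if "(v, xs) \<in> set (planted_adj ?r t)" for v xs
    using that adj_ne[of v xs ?r t] by (auto simp: planted_adj_def)
  have in_verts: "v \<in> verts T" if "(v, xs) \<in> set (planted_adj ?r t)" for v xs
  proof -
    have "v \<in> set (map fst (planted_adj ?r t))" using that by force
    then show ?thesis unfolding map_fst_planted_adj by (simp add: verts set_preorder)
  qed
  have int: "v \<in> range Internal \<longleftrightarrow> tl xs \<noteq> []" if "(v, xs) \<in> set (planted_adj ?r t)" for v xs
  proof (cases v)
    case (Boundary i)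
    then have "length xs = 1"
      using deg1[of v] in_verts[OF that] degree_rot_list[OF rl[OF that]]
      by (simp add: boundary_vertices_def)
    then show ?thesis using Boundary by (auto simp: length_Suc_conv)
  next
    case (Internal i)
    then have "length xs \<noteq> 1"
      using no1[of v] in_verts[OF that] degree_rot_list[OF rl[OF that]]
      by (simp add: internal_vertices_def)
    then show ?thesis using Internal xs_ne[OF that] by (cases xs) auto
  qed
  have "length xs \<noteq> 2" if "(v, xs) \<in> set (adj ?r t)" for v xs
  proof
    assume two: "length xs = 2"
    have vxs: "(v, xs) \<in> set (planted_adj ?r t)" using that by (simp add: planted_adj_def)
    then have "v \<in> range Internal" using int two by (cases xs) auto
    then show False
      using no2[of v] in_verts[OF vxs] degree_rot_list[OF rl[OF vxs]] two
      by (auto simp: internal_vertices_def)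
  qed
  then have "reduced t" using reduced_iff_adj[of t ?r] by auto
  have set_leaves: "set (leaves t) = Boundary ` {1..<n}"
  proof -
    have "set (leaves t) = boundary_vertices T - {?r}"
    proof (intro equalityI subsetI)
      fix v assume v: "v \<in> set (leaves t)"
      then obtain p where "(v, [p]) \<in> set (adj ?r t)" using set_leaves[of t ?r] by blast
      then have p: "(v, [p]) \<in> set (planted_adj ?r t)" by (simp add: planted_adj_def)
      have "v \<in> range Boundary" using int[OF p] by (cases v) auto
      moreover have "v \<noteq> ?r" using distinct v leaves_subset[of t] by (auto simp: set_preorder)
      ultimately show "v \<in> boundary_vertices T - {?r}"
        using in_verts[OF p] by (simp add: boundary_vertices_def)
    next
      fix v assume v: "v \<in> boundary_vertices T - {?r}"
      then have "v \<in> set (map fst (adj ?r t))"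
        unfolding map_fst_adj by (auto simp: boundary_vertices_def verts set_preorder)
      then obtain xs where xs: "(v, xs) \<in> set (adj ?r t)" by auto
      then have "tl xs = []" using v int[of v xs] by (auto simp: planted_adj_def boundary_vertices_def)
      then show "v \<in> set (leaves t)"
        using xs adj_ne[OF xs] set_leaves[of t ?r] by (cases xs) auto
    qed
    also have "\<dots> = Boundary ` {1..<n}" unfolding bd using n by (auto simp: image_iff)
    finally show ?thesis .
  qed
  \<comment> \<open>The contour from leaf \<open>n\<close> lists the leaves of \<open>t\<close> from
    left to right, and consecutive ones are related by \<open>next_boundary\<close>, whose values
    the labelling prescribes.\<close>
  have "tour T (?r, label t) (leaf_arcs ?r t) (label t, ?r)"
    using int in_verts by (intro tour_describes t)
      (fastforce simp: planted_adj_def internal_vertices_def)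
  then have "successively (next_boundary T) (?r # map snd (leaf_arcs ?r t) @ [?r])"
  proof (rule tour_successively)
    show "(?r, label t) \<in> arcs T" "?r \<in> boundary_vertices T" using t r \<open>(?r, u0) \<in> arcs T\<close> by auto
    show "\<forall>(p, b)\<in>set (leaf_arcs ?r t). b \<in> boundary_vertices T \<and> (b, p) \<in> arcs T"
    proof (clarify, intro conjI)
      fix p b assume pb: "(p, b) \<in> set (leaf_arcs ?r t)"
      then have "b \<in> set (map snd (leaf_arcs ?r t))" by force
      then have "b \<in> Boundary ` {1..<n}" unfolding map_snd_leaf_arcs set_leaves .
      then show "b \<in> boundary_vertices T" by (auto simp: bd)
      have "rot_list T b [p]" using leaf_arcs_adj[OF pb] rl by (simp add: planted_adj_def)
      then show "(b, p) \<in> arcs T" by (auto simp: rot_list_def neighbours_def)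
    qed
  qed
  then have "successively (next_boundary T) ((?r # leaves t) @ [?r])" by (simp add: map_snd_leaf_arcs)
  then have succ: "successively (next_boundary T) (?r # leaves t)"
    unfolding successively_append_iff by blast
  have "leaves t = map Boundary [1..<n]"
  proof (rule leaves_eq_upt[OF _ succ _ set_leaves])
    show "distinct (leaves t)" using distinct by (simp add: distinct_leaves)
    show "c = Boundary (if i = n then 1 else Suc i)"
      if "i \<in> {1..n}" "next_boundary T (Boundary i) c" for i c
      using next_boundary_unique[OF deg1 that(2) nb[OF that(1)]] that(1) by (auto simp: bd)
  qed (use n in simp)
  then have "represents n T t"
    using distinct verts rl int \<open>reduced t\<close> unfolding represents_def by blast
  then show thesis by (rule that)
qed

lemma represents_weight:
  assumes "represents n T t" "3 \<le> n"
  shows "weight f T = tree_weight f t"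
proof -
  let ?r = "Boundary n"
  note rep = representsD[OF assms(1)]
  have int: "internal_vertices T \<subseteq> set (preorder t)"
    using rep(2) by (auto simp: internal_vertices_def)
  have "weight f T = (\<Prod>v\<in>set (preorder t). if v \<in> range Internal then f (degree T v) else 1)"
    unfolding weight_def
    using int rep(2) by (intro prod.mono_neutral_cong_left) (auto simp: internal_vertices_def)
  also have "\<dots> = prod_list (map (\<lambda>v. if v \<in> range Internal then f (degree T v) else 1) (map fst (adj ?r t)))"
    unfolding map_fst_adj using rep(1) by (subst prod.distinct_set_conv_list) auto
  also have "\<dots> = tree_weight f t"
    unfolding tree_weight_adj[of f t ?r] map_map
  proof (intro arg_cong[where f = prod_list] map_cong refl, clarify)
    fix v xs assume "(v, xs) \<in> set (adj ?r t)"
    then have vxs: "(v, xs) \<in> set (planted_adj ?r t)" by (simp add: planted_adj_def)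
    show "((\<lambda>v. if v \<in> range Internal then f (degree T v) else 1) \<circ> fst) (v, xs) =
        (if tl xs = [] then 1 else f (length xs))"
      using rep(5)[OF vxs] degree_rot_list[OF rep(4)[OF vxs]] by simp
  qed
  finally show ?thesis .
qed

section \<open>Isomorphic trees have the same shape\<close>

text \<open>Vertices are matched by their position in preorder. As the shapes agree, this carries
  each neighbour list to a neighbour list, and the conditions on an isomorphism are read off from
  these lists.\<close>

lemma represents_iso:
  assumes S: "represents n S s" "arcs S \<subseteq> verts S \<times> verts S" "sym (arcs S)"
    and T: "represents n T t"
    and shape: "map_plane_tree (\<lambda>_. ()) s = map_plane_tree (\<lambda>_. ()) t"
  shows "planar_tree_iso S T"
proof -
  let ?r = "Boundary n"
  note S' = representsD[OF S(1)] and T' = representsD[OF T]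
  have "length (preorder s) = length (preorder t)"
    using arg_cong[OF shape, of "\<lambda>t. length (preorder t)"] by (simp only: preorder_map length_map)
  then obtain \<phi> where \<phi>: "map \<phi> (?r # preorder s) = ?r # preorder t"
    using exists_map[OF S'(1), of "?r # preorder t"] by auto
  then have t: "map_plane_tree \<phi> s = t" and \<phi>r: "\<phi> ?r = ?r"
    using map_plane_tree_of_preorder[OF shape] by auto
  have inj: "inj_on \<phi> (verts S)"
    using T'(1) unfolding S'(2) \<phi>[symmetric] distinct_map by blast
  have image: "\<phi> ` verts S = verts T"
    using arg_cong[OF \<phi>, of set] unfolding S'(2) T'(2) by simp
  have adj: "(\<phi> v, map \<phi> xs) \<in> set (planted_adj ?r t)" if "(v, xs) \<in> set (planted_adj ?r s)" for v xs
    using planted_adj_map[of \<phi> ?r s] that by (force simp: \<phi>r t)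
  have vertE: "\<exists>xs. (v, xs) \<in> set (planted_adj ?r s)" if "v \<in> verts S" for v
    using that unfolding S'(3) by force
  have nbrs: "set xs = neighbours S v" "set xs \<subseteq> verts S" if "(v, xs) \<in> set (planted_adj ?r s)" for v xs
  proof -
    show "set xs = neighbours S v" using S'(4)[OF that] by (simp add: rot_list_def)
    then show "set xs \<subseteq> verts S" using S(2) by (auto simp: neighbours_def)
  qed
  have int: "\<phi> v \<in> range Internal \<longleftrightarrow> v \<in> range Internal" if v: "v \<in> verts S" for v
  proof -
    obtain xs where "(v, xs) \<in> set (planted_adj ?r s)" using vertE[OF v] by blast
    then show ?thesis using S'(5) T'(5)[OF adj] by (simp add: map_tl[symmetric])
  qed
  show ?thesis
    unfolding planar_tree_iso_def
  proof (intro exI[of _ \<phi>] conjI ballI)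
    show "bij_betw \<phi> (verts S) (verts T)" using inj image by (simp add: bij_betw_def)
    show "\<phi> ` internal_vertices S = internal_vertices T"
      unfolding internal_vertices_def image[symmetric] using int by blast
    show "\<phi> b = b" if b: "b \<in> boundary_vertices S" for b
    proof (cases "b = ?r")
      case False
      obtain xs where xs: "(b, xs) \<in> set (planted_adj ?r s)"
        using vertE b by (auto simp: boundary_vertices_def)
      then have "tl xs = []" using S'(6) b by (auto simp: boundary_vertices_def)
      moreover have "(b, xs) \<in> set (adj ?r s)" using xs False by (simp add: planted_adj_def)
      ultimately have "b \<in> set (leaves s)"
        using adj_ne[of b xs ?r s] set_leaves[of s ?r] by (cases xs) auto
      \<comment> \<open>Both trees have the same leaf list, so a map that respects positions fixes
        every leaf.\<close>
      moreover have "map \<phi> (leaves s) = leaves s"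
        using leaves_map[of \<phi> s] S'(7) T'(7) by (simp add: t)
      ultimately show ?thesis by (simp add: map_idI list_eq_iff_nth_eq in_set_conv_nth) metis
    qed (simp add: \<phi>r)
    show "(\<phi> u, \<phi> v) \<in> arcs T \<longleftrightarrow> (u, v) \<in> arcs S" if "u \<in> verts S" "v \<in> verts S" for u v
    proof -
      from vertE[OF that(1)] obtain xs where xs: "(u, xs) \<in> set (planted_adj ?r s)" by blast
      have "(\<phi> u, \<phi> v) \<in> arcs T \<longleftrightarrow> \<phi> v \<in> \<phi> ` set xs"
        using T'(4)[OF adj[OF xs]] by (auto simp: rot_list_def neighbours_def)
      also have "\<dots> \<longleftrightarrow> v \<in> set xs" using inj nbrs(2)[OF xs] that by (auto dest: inj_onD)
      finally show ?thesis using nbrs(1)[OF xs] by (simp add: neighbours_def)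
    qed
    show "case uv of (u, v) \<Rightarrow> \<phi> (rot S v u) = rot T (\<phi> v) (\<phi> u)" if uv: "uv \<in> arcs S" for uv
    proof (clarify)
      fix u v assume "uv = (u, v)"
      then have vu: "(v, u) \<in> arcs S" "v \<in> verts S" using uv S(2,3) by (auto dest: symD)
      then obtain xs where xs: "(v, xs) \<in> set (planted_adj ?r s)" using vertE by blast
      have u: "u \<in> set xs" using vu nbrs(1)[OF xs] by (simp add: neighbours_def)
      have "map (rot T (\<phi> v)) (map \<phi> xs) = rotate1 (map \<phi> xs)"
        using T'(4)[OF adj[OF xs]] by (simp add: rot_list_def)
      also have "\<dots> = map \<phi> (map (rot S v) xs)"
        using S'(4)[OF xs] by (simp add: rot_list_def rotate1_map)
      finally show "\<phi> (rot S v u) = rot T (\<phi> v) (\<phi> u)" using u by simp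
    qed
  qed
qed

text \<open>Relabelling the tree of \<open>S\<close> along the isomorphism gives a tree that describes \<open>T\<close>.\<close>

lemma iso_same_shape:
  assumes S: "represents n S s" "arcs S \<subseteq> verts S \<times> verts S" "sym (arcs S)" "1 \<le> n"
    and T: "represents n T t" "arcs T \<subseteq> verts T \<times> verts T"
    and iso: "planar_tree_iso S T"
  shows "map_plane_tree (\<lambda>_. ()) s = map_plane_tree (\<lambda>_. ()) t"
proof -
  let ?r = "Boundary n"
  note S' = representsD[OF S(1)] and T' = representsD[OF T(1)]
  obtain \<phi> where bij: "bij_betw \<phi> (verts S) (verts T)"
    and bd: "\<forall>b\<in>boundary_vertices S. \<phi> b = b"
    and arcs: "\<forall>u\<in>verts S. \<forall>v\<in>verts S. (\<phi> u, \<phi> v) \<in> arcs T \<longleftrightarrow> (u, v) \<in> arcs S"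
    and rot: "\<forall>(u, v)\<in>arcs S. \<phi> (rot S v u) = rot T (\<phi> v) (\<phi> u)"
    using iso by (auto simp: planar_tree_iso_def)
  have \<phi>r: "\<phi> ?r = ?r" using bd S'(2) by (auto simp: boundary_vertices_def)
  have rl: "rot_list T (\<phi> v) (map \<phi> xs)" if vxs: "(v, xs) \<in> set (planted_adj ?r s)" for v xs
    unfolding rot_list_def
  proof (intro conjI)
    have v: "v \<in> verts S" using vxs unfolding S'(3) by force
    have d: "distinct xs" and xs: "set xs = neighbours S v" and r: "map (rot S v) xs = rotate1 xs"
      using S'(4)[OF vxs] by (auto simp: rot_list_def)
    have sub: "set xs \<subseteq> verts S" using xs S(2) by (auto simp: neighbours_def)
    show "distinct (map \<phi> xs)"
      using d sub bij by (auto simp: distinct_map bij_betw_def intro: inj_on_subset)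
    show "set (map \<phi> xs) = neighbours T (\<phi> v)"
    proof (intro equalityI subsetI)
      fix w assume "w \<in> set (map \<phi> xs)"
      then show "w \<in> neighbours T (\<phi> v)" using xs sub arcs v by (auto simp: neighbours_def)
    next
      fix w assume w: "w \<in> neighbours T (\<phi> v)"
      then have "w \<in> verts T" using T(2) by (auto simp: neighbours_def)
      then obtain u where "u \<in> verts S" "w = \<phi> u" using bij by (auto simp: bij_betw_def)
      then show "w \<in> set (map \<phi> xs)" using w xs arcs v by (auto simp: neighbours_def)
    qed
    have "\<phi> (rot S v u) = rot T (\<phi> v) (\<phi> u)" if "u \<in> set xs" for u
    proof -
      have "(u, v) \<in> arcs S" using that xs S(3) by (auto simp: neighbours_def dest: symD)
      then show ?thesis using rot by auto
    qed
    then have "map (rot T (\<phi> v)) (map \<phi> xs) = map \<phi> (map (rot S v) xs)" by simp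
    then show "map (rot T (\<phi> v)) (map \<phi> xs) = rotate1 (map \<phi> xs)" by (simp add: r rotate1_map)
  qed
  have "describes T ?r (map_plane_tree \<phi> s)"
    using rl adj_map[of \<phi> ?r s] by (auto simp: describes_def planted_adj_def \<phi>r)
  moreover have "label (map_plane_tree \<phi> s) = label t"
  proof -
    have "rot_list T ?r [label t]" using T'(4) by (auto simp: planted_adj_def)
    moreover have "rot_list T ?r [\<phi> (label s)]" using rl[of ?r "[label s]"] by (simp add: planted_adj_def \<phi>r)
    ultimately show ?thesis by (simp add: rot_list_def label_map) (metis singleton_inject)
  qed
  \<comment> \<open>Two trees that describe \<open>T\<close> from the same arc coincide, so
    \<open>t\<close> is a relabelling of \<open>s\<close>.\<close>
  ultimately have "map_plane_tree \<phi> s = t" using describes_unique T'(9) by blast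
  then show ?thesis by (auto simp: plane_tree.map_comp comp_def)
qed

section \<open>Every shape occurs\<close>

text \<open>The leaves get consecutive numbers from \<open>i\<close> on; those of the internal vertices may have gaps.\<close>

fun numbered :: "nat \<Rightarrow> nat \<Rightarrow> 'v plane_tree \<Rightarrow> vertex plane_tree"
  and numbered_list :: "nat \<Rightarrow> nat \<Rightarrow> 'v plane_tree list \<Rightarrow> vertex plane_tree list" where
  "numbered i k (Node v ts) =
     (if ts = [] then Node (Boundary i) [] else Node (Internal k) (numbered_list i (Suc k) ts))"
| "numbered_list i k [] = []"
| "numbered_list i k (t # ts) =
     numbered i k t # numbered_list (i + length (leaves t)) (k + length (preorder t)) ts"

lemma numbered_list_eq_Nil [simp]: "numbered_list i k ts = [] \<longleftrightarrow> ts = []"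
  by (cases ts) auto

lemma upt_append: "[i..<i + a] @ [i + a..<i + a + b] = [i..<i + (a + b)]"
  by (metis add.assoc le_add1 upt_add_eq_append)

lemma shape_numbered:
  fixes t :: "'v plane_tree" and ts :: "'v plane_tree list"
  shows
  "map_plane_tree (\<lambda>_. ()) (numbered i k t) = map_plane_tree (\<lambda>_. ()) t"
  "map (map_plane_tree (\<lambda>_. ())) (numbered_list i k ts) = map (map_plane_tree (\<lambda>_. ())) ts"
  by (induction i k t and i k ts rule: numbered_numbered_list.induct) auto

lemma leaves_numbered:
  fixes t :: "'v plane_tree" and ts :: "'v plane_tree list"
  shows
  "leaves (numbered i k t) = map Boundary [i..<i + length (leaves t)]"
  "concat (map leaves (numbered_list i k ts)) =
     map Boundary [i..<i + length (concat (map leaves ts))]"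
  by (induction i k t and i k ts rule: numbered_numbered_list.induct)
    (auto simp: upt_append simp flip: map_append)

text \<open>Sibling subtrees draw their labels from disjoint intervals. The interval for internal
  vertices is as long as the preorder, leaves included, whence the gaps.\<close>

lemma preorder_numbered:
  fixes t :: "'v plane_tree" and ts :: "'v plane_tree list"
  shows
  "distinct (preorder (numbered i k t)) \<and> set (preorder (numbered i k t)) \<subseteq>
     Boundary ` {i..<i + length (leaves t)} \<union> Internal ` {k..<k + length (preorder t)}"
  "distinct (concat (map preorder (numbered_list i k ts))) \<and>
     set (concat (map preorder (numbered_list i k ts))) \<subseteq>
     Boundary ` {i..<i + length (concat (map leaves ts))} \<union>
     Internal ` {k..<k + length (concat (map preorder ts))}"
proof (induction i k t and i k ts rule: numbered_numbered_list.induct)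
  case (1 i k v ts)
  then show ?case by (fastforce simp: image_iff)
next
  case (3 i k t ts)
  let ?P = "set (preorder (numbered i k t))"
    and ?Q = "set (concat (map preorder (numbered_list (i + length (leaves t)) (k + length (preorder t)) ts)))"
  have "?P \<inter> ?Q \<subseteq>
      (Boundary ` {i..<i + length (leaves t)} \<union> Internal ` {k..<k + length (preorder t)}) \<inter>
      (Boundary ` {i + length (leaves t)..} \<union> Internal ` {k + length (preorder t)..})"
  proof (rule Int_mono)
    show "?P \<subseteq> Boundary ` {i..<i + length (leaves t)} \<union> Internal ` {k..<k + length (preorder t)}"
      by (rule 3(1)[THEN conjunct2])
    show "?Q \<subseteq> Boundary ` {i + length (leaves t)..} \<union> Internal ` {k + length (preorder t)..}"
      by (rule subset_trans[OF 3(2)[THEN conjunct2]]) (intro Un_mono image_mono, auto)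
  qed
  also have "\<dots> = {}" by auto
  finally have "?P \<inter> ?Q = {}" by blast
  moreover have "?P \<union> ?Q \<subseteq>
      Boundary ` {i..<i + length (concat (map leaves (t # ts)))} \<union>
      Internal ` {k..<k + length (concat (map preorder (t # ts)))}"
  proof (intro Un_least)
    show "?P \<subseteq> Boundary ` {i..<i + length (concat (map leaves (t # ts)))} \<union>
      Internal ` {k..<k + length (concat (map preorder (t # ts)))}"
      by (rule subset_trans[OF 3(1)[THEN conjunct2]]) (intro Un_mono image_mono, auto)
    show "?Q \<subseteq> Boundary ` {i..<i + length (concat (map leaves (t # ts)))} \<union>
      Internal ` {k..<k + length (concat (map preorder (t # ts)))}"
      by (rule subset_trans[OF 3(2)[THEN conjunct2]]) (intro Un_mono image_mono, auto)
  qed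
  ultimately show ?case using 3 by simp
qed simp

lemma internal_numbered:
  fixes t :: "'v plane_tree" and ts :: "'v plane_tree list"
  shows
  "\<forall>(v, xs)\<in>set (adj u (numbered i k t)). v \<in> range Internal \<longleftrightarrow> tl xs \<noteq> []"
  "\<forall>s\<in>set (numbered_list i k ts). \<forall>u. \<forall>(v, xs)\<in>set (adj u s). v \<in> range Internal \<longleftrightarrow> tl xs \<noteq> []"
  by (induction i k t and i k ts arbitrary: u rule: numbered_numbered_list.induct) auto

lemma reduced_shape: "map_plane_tree (\<lambda>_. ()) s = map_plane_tree (\<lambda>_. ()) t \<Longrightarrow> reduced s = reduced t"
  by (metis reduced_map)

lemma represents_graph_of:
  assumes "reduced t" "length (leaves t) = n - 1"
  shows "represents n (graph_of (Boundary n) (numbered 1 0 t)) (numbered 1 0 t)"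
proof -
  let ?r = "Boundary n" and ?t = "numbered 1 0 t"
  have distinct: "distinct (?r # preorder ?t)"
  proof -
    \<comment> \<open>A tree has a leaf, so \<open>n - 1\<close> is not truncated; the leaf labels
      starting at 1 stop just below \<open>n\<close>, and \<open>Boundary n\<close> is free for the
      root.\<close>
    have "1 + length (leaves t) = n" using assms(2) length_leaves_pos[of t] by linarith
    then show ?thesis using preorder_numbered(1)[of 1 0 t] by auto
  qed
  have "leaves ?t = map Boundary [1..<n]"
    using leaves_numbered(1)[of 1 0 t] assms length_leaves_pos[of t] by simp
  moreover have "reduced ?t" using assms reduced_shape[OF shape_numbered(1)] by metis
  ultimately show ?thesis
    unfolding represents_def
    using distinct rot_list_graph_of[OF distinct] internal_numbered(1)[of ?r 1 0 t]
    by (auto simp: graph_of_def planted_adj_def)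
qed

lemma successively_nth: "successively P xs \<Longrightarrow> Suc i < length xs \<Longrightarrow> P (xs ! i) (xs ! Suc i)"
proof (induction xs arbitrary: i)
  case (Cons x xs)
  then show ?case by (cases i; cases xs) auto
qed simp

text \<open>The contour argument read backwards: the tour of \<open>t\<close> lists the leaves 1 to
  \<open>n - 1\<close> between two visits to leaf \<open>n\<close>, which is the clockwise
  condition.\<close>

lemma represented_graph_reduced_tree:
  assumes "represents n T t" "is_tree (verts T) (arcs T)" "3 \<le> n"
  shows "T \<in> reduced_trees n"
proof -
  let ?r = "Boundary n"
  note rep = representsD[OF assms(1)]
  have vertE: "\<exists>xs. (v, xs) \<in> set (planted_adj ?r t)" if "v \<in> verts T" for v
    using that unfolding rep(3) by force
  have ne: "xs \<noteq> []" if "(v, xs) \<in> set (planted_adj ?r t)" for v xs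
    using that adj_ne[of v xs ?r t] by (auto simp: planted_adj_def)
  have deg: "degree T v = length xs" if "(v, xs) \<in> set (planted_adj ?r t)" for v xs
    by (rule degree_rot_list[OF rep(4)[OF that]])
  have int: "3 \<le> degree T v" if v: "v \<in> internal_vertices T" for v
  proof -
    obtain xs where xs: "(v, xs) \<in> set (planted_adj ?r t)" using v vertE by (auto simp: internal_vertices_def)
    then have "tl xs \<noteq> []" using rep(5) v by (auto simp: internal_vertices_def)
    moreover have "(v, xs) \<in> set (adj ?r t)" using xs v by (auto simp: planted_adj_def internal_vertices_def)
    then have "length xs \<noteq> 2" using rep(8) reduced_iff_adj[of t ?r] by auto
    moreover have "2 \<le> length xs" using \<open>tl xs \<noteq> []\<close> by (cases xs; cases "tl xs") auto
    ultimately show ?thesis using deg[OF xs] by linarith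
  qed
  have leafE: "\<exists>p. (b, [p]) \<in> set (planted_adj ?r t)" if b: "b \<in> boundary_vertices T" for b
  proof -
    obtain xs where xs: "(b, xs) \<in> set (planted_adj ?r t)" using b vertE by (auto simp: boundary_vertices_def)
    then have "tl xs = []" using b rep(6) by (auto simp: boundary_vertices_def)
    then show ?thesis using xs ne[OF xs] by (cases xs) auto
  qed
  have bd: "boundary_vertices T = Boundary ` {1..n}"
  proof -
    have "boundary_vertices T = insert ?r (set (leaves t))"
    proof (intro equalityI subsetI)
      fix b assume "b \<in> boundary_vertices T"
      then show "b \<in> insert ?r (set (leaves t))"
        using leafE[of b] set_leaves[of t ?r] by (auto simp: planted_adj_def)
    next
      fix b assume "b \<in> insert ?r (set (leaves t))"
      then show "b \<in> boundary_vertices T"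
        using rep(2,7) leaves_subset[of t] by (auto simp: boundary_vertices_def set_preorder)
    qed
    also have "\<dots> = Boundary ` insert n {1..<n}" using rep(7) by simp
    also have "insert n {1..<n} = {1..n}" using assms(3) by auto
    finally show ?thesis .
  qed
  have arc: "(v, w) \<in> arcs T \<longleftrightarrow> w \<in> set xs" if "(v, xs) \<in> set (planted_adj ?r t)" for v w xs
    using rep(4)[OF that] by (auto simp: rot_list_def neighbours_def)
  have "tour T (?r, label t) (leaf_arcs ?r t) (label t, ?r)"
  proof (rule tour_describes[OF rep(9)], clarify)
    fix v xs assume "(v, xs) \<in> set (adj ?r t)" "tl xs \<noteq> []"
    then have vxs: "(v, xs) \<in> set (planted_adj ?r t)" by (simp add: planted_adj_def)
    then have "v \<in> verts T" unfolding rep(3) by force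
    then show "v \<in> internal_vertices T" using rep(5)[OF vxs] \<open>tl xs \<noteq> []\<close> by (simp add: internal_vertices_def)
  qed
  then have "successively (next_boundary T) (?r # map snd (leaf_arcs ?r t) @ [?r])"
  proof (rule tour_successively)
    show "(?r, label t) \<in> arcs T" by (rule iffD2[OF arc[of _ "[label t]"]]) (auto simp: planted_adj_def)
    show "?r \<in> boundary_vertices T" using assms(3) by (simp add: bd)
    show "\<forall>(p, b)\<in>set (leaf_arcs ?r t). b \<in> boundary_vertices T \<and> (b, p) \<in> arcs T"
    proof (clarify, intro conjI)
      fix p b assume pb: "(p, b) \<in> set (leaf_arcs ?r t)"
      then have "b \<in> set (map snd (leaf_arcs ?r t))" by force
      then show "b \<in> boundary_vertices T" unfolding map_snd_leaf_arcs rep(7) bd by auto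
      show "(b, p) \<in> arcs T"
        using leaf_arcs_adj[OF pb] arc[of b "[p]"] by (simp add: planted_adj_def)
    qed
  qed
  then have succ: "successively (next_boundary T) (map Boundary (n # [1..<n] @ [n]))"
    by (simp add: map_snd_leaf_arcs rep(7))
  have next_bd: "next_boundary T (Boundary i) (Boundary (if i = n then 1 else Suc i))" if i: "i \<in> {1..n}" for i
  proof -
    let ?bs = "map Boundary (n # [1..<n] @ [n])"
    have nth: "?bs ! j = Boundary j" if "1 \<le> j" "j \<le> n" for j
      using that by (cases j) (auto simp: nth_append)
    \<comment> \<open>The label \<open>n\<close> stands at positions 0 and \<open>n\<close> of
      \<open>?bs\<close>; only the former has a successor, namely 1.\<close>
    define j where "j = (if i = n then 0 else i)"
    have "next_boundary T (?bs ! j) (?bs ! Suc j)"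
      using i by (intro successively_nth[OF succ]) (auto simp: j_def)
    moreover have "?bs ! j = Boundary i" using nth[of i] i by (auto simp: j_def)
    moreover have "?bs ! Suc j = Boundary (if i = n then 1 else Suc i)"
      using nth[of "Suc j"] i by (auto simp: j_def)
    ultimately show ?thesis by metis
  qed
  have "cyclic_on (rot T v) (neighbours T v)" if "v \<in> verts T" for v
  proof -
    from vertE[OF that] obtain xs where xs: "(v, xs) \<in> set (planted_adj ?r t)" by blast
    then show ?thesis using cyclic_on_of_rotate1[OF _ ne[OF xs], of "rot T v"] rep(4)[OF xs]
      by (simp add: rot_list_def)
  qed
  moreover have "degree T b = 1" if "b \<in> boundary_vertices T" for b
    using leafE[OF that] deg by auto
  ultimately have "planar_tree n T"
    using assms(2) bd next_bd unfolding planar_tree_def by blast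
  then show ?thesis using int assms(3) unfolding reduced_trees_def series_reduced_def by fastforce
qed

section \<open>Counting classes by shapes\<close>

definition canonical :: "nat \<Rightarrow> unit plane_tree \<Rightarrow> plane_graph" where
  "canonical n t = graph_of (Boundary n) (numbered 1 0 t)"

lemma represents_canonical:
  assumes "t \<in> shapes (n - 1)"
  shows "represents n (canonical n t) (numbered 1 0 t)"
  unfolding canonical_def
  by (rule represents_graph_of) (use assms in \<open>simp_all add: shapes_def\<close>)

lemma canonical_reduced_tree:
  assumes "t \<in> shapes (n - 1)" "3 \<le> n"
  shows "canonical n t \<in> reduced_trees n"
proof (rule represented_graph_reduced_tree[OF represents_canonical[OF assms(1)] _ assms(2)])
  show "is_tree (verts (canonical n t)) (arcs (canonical n t))"
    using is_tree_graph_of[OF representsD(1)[OF represents_canonical[OF assms(1)]]]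
    by (simp add: canonical_def)
qed

lemma unit_map_plane_tree: "map_plane_tree (\<lambda>_. ()) (t :: unit plane_tree) = t"
  by (simp add: plane_tree.map_ident_strong)

text \<open>Injectivity holds because isomorphic trees have the same shape. For surjectivity, any
  tree is isomorphic to the canonical graph of the shape of a tree representing it.\<close>

lemma bij_betw_shapes_tree_classes:
  assumes n: "3 \<le> n"
  shows "bij_betw (\<lambda>t. reduced_tree_rel n `` {canonical n t}) (shapes (n - 1)) (tree_classes n)"
proof (rule bij_betwI')
  fix s t assume s: "s \<in> shapes (n - 1)" and t: "t \<in> shapes (n - 1)"
  note S = canonical_reduced_tree[OF s n] and T = canonical_reduced_tree[OF t n]
  show "(reduced_tree_rel n `` {canonical n s} = reduced_tree_rel n `` {canonical n t}) = (s = t)"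
  proof
    assume "reduced_tree_rel n `` {canonical n s} = reduced_tree_rel n `` {canonical n t}"
    then have "(canonical n s, canonical n t) \<in> reduced_tree_rel n"
      using eq_equiv_class[OF _ equiv_reduced_tree_rel T] by blast
    then have "planar_tree_iso (canonical n s) (canonical n t)" by (simp add: reduced_tree_rel_def)
    then have "map_plane_tree (\<lambda>_. ()) (numbered 1 0 s) = map_plane_tree (\<lambda>_. ()) (numbered 1 0 t)"
      using n by (intro iso_same_shape[OF represents_canonical[OF s] reduced_treesD(1,2)[OF S] _
          represents_canonical[OF t] reduced_treesD(1)[OF T]]) auto
    then show "s = t" by (simp add: shape_numbered unit_map_plane_tree)
  qed simp
next
  fix t assume "t \<in> shapes (n - 1)"
  then show "reduced_tree_rel n `` {canonical n t} \<in> tree_classes n"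
    unfolding tree_classes_def using canonical_reduced_tree n by (intro quotientI) auto
next
  fix C assume "C \<in> tree_classes n"
  then obtain T where T: "T \<in> reduced_trees n" and C: "C = reduced_tree_rel n `` {T}"
    unfolding tree_classes_def by (auto elim: quotientE)
  obtain t where t: "represents n T t" by (rule exists_representation[OF T n])
  let ?s = "map_plane_tree (\<lambda>_. ()) t"
  have s: "?s \<in> shapes (n - 1)"
    using representsD(7,8)[OF t] by (simp add: shapes_def reduced_map leaves_map)
  note S = canonical_reduced_tree[OF s n]
  have "planar_tree_iso (canonical n ?s) T"
    by (rule represents_iso[OF represents_canonical[OF s] reduced_treesD(1,2)[OF S] t])
      (simp add: shape_numbered unit_map_plane_tree)
  then have "(canonical n ?s, T) \<in> reduced_tree_rel n" using S T by (simp add: reduced_tree_rel_def)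
  then have "C = reduced_tree_rel n `` {canonical n ?s}"
    unfolding C using equiv_class_eq[OF equiv_reduced_tree_rel] by metis
  then show "\<exists>t\<in>shapes (n - 1). C = reduced_tree_rel n `` {canonical n t}" using s by blast
qed

lemma tree_sum_eq:
  assumes n: "3 \<le> n"
  shows "tree_sum f n = (\<Sum>t\<in>shapes (n - 1). tree_weight f t)"
proof -
  let ?c = "\<lambda>t. reduced_tree_rel n `` {canonical n t}"
  have "weight f (SOME T. T \<in> ?c t) = tree_weight f t" if t: "t \<in> shapes (n - 1)" for t
  proof -
    have "weight f (SOME T. T \<in> ?c t) = weight f (canonical n t)"
    proof (rule weight_class)
      show "?c t \<in> tree_classes n" using bij_betw_shapes_tree_classes[OF n] t by (auto simp: bij_betw_def)
      show "canonical n t \<in> ?c t"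
        by (rule equiv_class_self[OF equiv_reduced_tree_rel canonical_reduced_tree[OF t n]])
    qed
    also have "\<dots> = tree_weight f (numbered 1 0 t)" by (rule represents_weight[OF represents_canonical[OF t] n])
    also have "\<dots> = tree_weight f t" using shape_numbered(1) tree_weight_map by metis
    finally show ?thesis .
  qed
  then show ?thesis
    unfolding tree_sum_def sum.reindex_bij_betw[OF bij_betw_shapes_tree_classes[OF n], symmetric]
    by (intro sum.cong refl)
qed

theorem theorem3p2:
  fixes f :: "nat \<Rightarrow> 'a::field"
  shows "H_tree f / fps_X = fps_inv (fps_X - F_series f / fps_X)"
proof -
  have "shapes 1 = {Node () []}" by (subst shapes_unfold) auto
  \<comment> \<open>A shape with \<open>m\<close> leaves belongs to \<open>Suc m\<close> boundary
    vertices. The single node accounts for the term \<open>fps_X ^ 2\<close>, and for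
    \<open>m = 0\<close> both sides vanish.\<close>
  then have "shape_series f $ m = H_tree f $ Suc m" for m
    using shapes_0 by (cases "m < 2")
      (auto simp: shape_series_nth H_tree_def tree_sum_eq fps_X_power_nth less_2_cases_iff)
  then have "H_tree f / fps_X = shape_series f" by (intro fps_ext) simp
  then show ?thesis by (simp only: shape_series_fps_inv)
qed

end
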